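(* Let $C_n$ be the cycle on $n$ vertices, $n\ge3$, and let $\mathbf{X}_{C_n}=\sum_{\lambda\vdash n}c_\lambda\,\mathfrak{st}_\lambda$ be its star-expansion. Then for $\lambda=(1^{m_1}2^{m_2}\cdots n^{m_n})\vdash n$ we have: \begin{itemize} \item if $\lambda=(n-m_1,1^{m_1})$ is a hook with $0\le m_1\le n-2$, then \[c_\lambda=(-1)^{m_1}\left[-\binom{n-2}{m_1-1}+(n-1)\binom{n-2}{m_1}\right];\] \item if $\lambda$ is not a hook partition, then \[c_\lambda=(-1)^{m_1}\frac{n}{\ell(\lambda)-m_1}\binom{m_2+\cdots+m_n}{m_2,\dots,m_n}\binom{n-\ell(\lambda)+m_1-1}{m_1};\] \item $c_{(1^n)}=0$. \end{itemize}
   Context: The chromatic symmetric function of a finite simple graph $G$ with vertices $v_1,\dots,v_n$ is $\mathbf{X}_G=\sum_\kappa x_{\kappa(v_1)}\cdots x_{\kappa(v_n)}$, summed over all proper colorings $\kappa:V(G)\to\mathbb{N}$. The star graph $\mathsf{St}_k$ on $k$ vertices is the tree with one central vertex adjacent to $k-1$ leaves ($\mathsf{St}_1$ is a single vertex); $\mathfrak{st}_k:=\mathbf{X}_{\mathsf{St}_k}$, and $\mathfrak{st}_\lambda:=\mathfrak{st}_{\lambda_1}\mathfrak{st}_{\lambda_2}\cdots$ for a partition $\lambda$. The set $\{\mathfrak{st}_\lambda:\lambda\vdash n\}$ is a $\mathbb{Q}$-basis (the star-basis) of the space of homogeneous symmetric functions of degree $n$, so the coefficients $c_\lambda$ are uniquely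 determined. The notation $\lambda=(1^{m_1}2^{m_2}\cdots n^{m_n})$ means $\lambda$ has exactly $m_i$ parts equal to $i$; $\ell(\lambda)$ is the number of parts. A hook partition of $n$ is one of the form $(a,1^{n-a})$ with $1\le a\le n$ (so $(1^n)$ counts as a hook). $\binom{m_2+\cdots+m_n}{m_2,\dots,m_n}=\frac{(m_2+\cdots+m_n)!}{m_2!\cdots m_n!}$, and $\binom ab=0$ for $a\ge0$ and $b<0$ or $b>a$. *)

theory Defs
  imports Complex_Main "HOL-Library.Multiset" "HOL-Library.FuncSet"
begin

section \<open>Formal power series in the variables $x_0, x_1, x_2, \ldots$ over the rationals\<close>

text \<open>
  The monomial $x_{i_1} \cdots x_{i_k}$ is encoded as the multiset of its indices
  $i_1, \ldots, i_k$, so that multiplication of monomials is addition of multisets.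
  A series is the family of its coefficients.
\<close>

typedef mseries = "UNIV :: (nat multiset \<Rightarrow> rat) set"
  morphisms mcoeff Mseries
  by simp

lemma mcoeff_Mseries [simp]: "mcoeff (Mseries f) = f"
  by (simp add: Mseries_inverse)

lemma mseries_eqI: "(\<And>M. mcoeff f M = mcoeff g M) \<Longrightarrow> f = g"
  by (metis ext mcoeff_inject)

definition splits :: "nat multiset \<Rightarrow> (nat multiset \<times> nat multiset) set" where
  "splits M = {(A, B). A + B = M}"

lemma finite_submultisets: "finite {A :: 'a multiset. A \<subseteq># M}"
proof (rule finite_subset)
  show "{A. A \<subseteq># M} \<subseteq> (\<Union>k\<le>size M. multisets_of_size (set_mset M) k)"
    using set_mset_mono size_mset_mono by (force simp: multisets_of_size_def)
qed auto

lemma finite_splits [simp, intro]: "finite (splits M)"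
  by (rule finite_subset[of _ "{A. A \<subseteq># M} \<times> {A. A \<subseteq># M}"])
    (auto simp: splits_def finite_submultisets)

instantiation mseries :: comm_ring_1
begin

definition zero_mseries where "0 = Mseries (\<lambda>M. 0)"
definition one_mseries where "1 = Mseries (\<lambda>M. if M = {#} then 1 else 0)"
definition plus_mseries where "f + g = Mseries (\<lambda>M. mcoeff f M + mcoeff g M)"
definition minus_mseries where "f - g = Mseries (\<lambda>M. mcoeff f M - mcoeff g M)"
definition uminus_mseries where "- f = Mseries (\<lambda>M. - mcoeff f M)"
definition times_mseries where
  "f * g = Mseries (\<lambda>M. \<Sum>(A, B)\<in>splits M. mcoeff f A * mcoeff g B)"

instance
proof
  fix f g h :: mseries
  show "f * g * h = f * (g * h)"
  proof (rule mseries_eqI)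
    fix M
    let ?t = "\<lambda>A B C. mcoeff f A * mcoeff g B * mcoeff h C"
    have "mcoeff (f * g * h) M =
        (\<Sum>((P, C), (A, B))\<in>Sigma (splits M) (\<lambda>p. splits (fst p)). ?t A B C)"
      by (simp add: times_mseries_def sum_distrib_right case_prod_unfold sum.Sigma)
    also have "\<dots> = (\<Sum>((A, Q), (B, C))\<in>Sigma (splits M) (\<lambda>p. splits (snd p)). ?t A B C)"
      by (rule sum.reindex_bij_witness
          [where i = "\<lambda>((A, Q), (B, C)). ((A + B, C), (A, B))"
            and j = "\<lambda>((P, C), (A, B)). ((A, B + C), (B, C))"])
        (auto simp: splits_def add.assoc)
    also have "\<dots> = mcoeff (f * (g * h)) M"
      by (simp add: times_mseries_def sum_distrib_left case_prod_unfold sum.Sigma mult.assoc)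
    finally show "mcoeff (f * g * h) M = mcoeff (f * (g * h)) M" .
  qed
  show "f * g = g * f"
  proof (rule mseries_eqI)
    fix M
    show "mcoeff (f * g) M = mcoeff (g * f) M"
      unfolding times_mseries_def mcoeff_Mseries
      by (rule sum.reindex_bij_witness[where i = prod.swap and j = prod.swap])
        (auto simp: splits_def add.commute)
  qed
  show "1 * f = f"
  proof (rule mseries_eqI)
    fix M
    have "mcoeff (1 * f) M = (\<Sum>p\<in>splits M. if p = ({#}, M) then mcoeff f M else 0)"
      unfolding times_mseries_def one_mseries_def mcoeff_Mseries
      by (rule sum.cong) (auto simp: splits_def split: if_splits)
    also have "\<dots> = mcoeff f M"
      by (simp add: sum.delta) (simp add: splits_def)
    finally show "mcoeff (1 * f) M = mcoeff f M" .
  qed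
  show "(f + g) * h = f * h + g * h"
    by (rule mseries_eqI)
      (simp add: times_mseries_def plus_mseries_def distrib_right sum.distrib case_prod_unfold)
  have "mcoeff 0 {#} \<noteq> mcoeff 1 {#}"
    by (simp add: zero_mseries_def one_mseries_def)
  then show "(0::mseries) \<noteq> 1"
    by auto
  show "f + g + h = f + (g + h)" "f + g = g + f" "0 + f = f" "- f + f = 0" "f - g = f + - g"
    by (rule mseries_eqI, simp add: plus_mseries_def minus_mseries_def uminus_mseries_def
        zero_mseries_def)+
qed

end

definition mscale :: "rat \<Rightarrow> mseries \<Rightarrow> mseries" (infixr \<open>*\<^sub>Q\<close> 75) where
  "c *\<^sub>Q f = Mseries (\<lambda>M. c * mcoeff f M)"


section \<open>Chromatic symmetric functions\<close>

text \<open>A graph is a pair of a vertex set and a set of edges, each a two-element vertex set.\<close>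

type_synonym 'a graph = "'a set \<times> 'a set set"

definition finite_simple_graph :: "'a graph \<Rightarrow> bool" where
  "finite_simple_graph G \<longleftrightarrow> finite (fst G) \<and> (\<forall>e\<in>snd G. e \<subseteq> fst G \<and> card e = 2)"

text \<open>Colorings are extensional functions, so that each is counted once.\<close>

definition proper_colorings :: "'a graph \<Rightarrow> ('a \<Rightarrow> nat) set" where
  "proper_colorings G =
    {\<kappa> \<in> fst G \<rightarrow>\<^sub>E UNIV. \<forall>u v. {u, v} \<in> snd G \<longrightarrow> \<kappa> u \<noteq> \<kappa> v}"

text \<open>
  The coefficient of a monomial is the number of proper colorings with that monomial.
  By the following lemma this number is the cardinality of a finite set.
\<close>

definition chromatic_sf :: "'a graph \<Rightarrow> mseries" where
  "chromatic_sf G = Mseries (\<lambda>M. of_nat (card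
    {\<kappa> \<in> proper_colorings G. image_mset \<kappa> (mset_set (fst G)) = M}))"

lemma finite_colorings_monomial:
  assumes "finite (fst G)"
  shows "finite {\<kappa> \<in> proper_colorings G. image_mset \<kappa> (mset_set (fst G)) = M}"
proof (rule finite_subset)
  show "{\<kappa> \<in> proper_colorings G. image_mset \<kappa> (mset_set (fst G)) = M}
      \<subseteq> fst G \<rightarrow>\<^sub>E set_mset M"
    using assms by (auto simp: proper_colorings_def PiE_def)
  show "finite (fst G \<rightarrow>\<^sub>E set_mset M)"
    using assms by (intro finite_PiE) auto
qed

definition cycle_graph :: "nat \<Rightarrow> nat graph" where
  "cycle_graph n = ({..<n}, {{i, (i + 1) mod n} |i. i < n})"

text \<open>The center of the star is the vertex 0.\<close>

definition star_graph :: "nat \<Rightarrow> nat graph" where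
  "star_graph k = ({..<k}, {{0, i} |i. 1 \<le> i \<and> i < k})"

lemma finite_simple_cycle_graph: "n \<ge> 3 \<Longrightarrow> finite_simple_graph (cycle_graph n)"
  by (auto simp: finite_simple_graph_def cycle_graph_def card_insert_if mod_Suc split: if_splits)

lemma finite_simple_star_graph: "finite_simple_graph (star_graph k)"
  by (auto simp: finite_simple_graph_def star_graph_def)


section \<open>Partitions and the star-expansion\<close>

text \<open>
  A partition is the multiset of its positive parts; thus \<open>size \<mu>\<close> is its length
  and \<open>count \<mu> i\<close> is the multiplicity $m_i$.
\<close>

definition partitions :: "nat \<Rightarrow> nat multiset set" where
  "partitions n = {\<mu>. sum_mset \<mu> = n \<and> 0 \<notin># \<mu>}"

lemma finite_partitions: "finite (partitions n)"
proof (rule finite_subset)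
  show "partitions n \<subseteq> (\<Union>k\<le>n. multisets_of_size {..n} k)"
  proof
    fix \<mu> assume "\<mu> \<in> partitions n"
    then have sum: "sum_mset \<mu> = n" and pos: "0 \<notin># \<mu>"
      by (auto simp: partitions_def)
    from pos have "size \<mu> \<le> sum_mset \<mu>"
      by (induction \<mu>) auto
    moreover have "i \<le> sum_mset \<mu>" if "i \<in># \<mu>" for i
      using multi_member_split[OF that] by auto
    ultimately show "\<mu> \<in> (\<Union>k\<le>n. multisets_of_size {..n} k)"
      using sum by (auto simp: multisets_of_size_def)
  qed
qed auto

definition is_hook :: "nat \<Rightarrow> nat multiset \<Rightarrow> bool" where
  "is_hook n \<mu> \<longleftrightarrow> (\<exists>a. 1 \<le> a \<and> a \<le> n \<and> \<mu> = add_mset a (replicate_mset (n - a) 1))"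

definition star_sf :: "nat \<Rightarrow> mseries" where
  "star_sf k = chromatic_sf (star_graph k)"

definition star_sf_partition :: "nat multiset \<Rightarrow> mseries" where
  "star_sf_partition \<mu> = (\<Prod>k\<in>#\<mu>. star_sf k)"

definition is_star_expansion :: "nat \<Rightarrow> mseries \<Rightarrow> (nat multiset \<Rightarrow> rat) \<Rightarrow> bool" where
  "is_star_expansion n f c \<longleftrightarrow> f = (\<Sum>\<mu>\<in>partitions n. c \<mu> *\<^sub>Q star_sf_partition \<mu>)"


section \<open>Binomial and multinomial coefficients\<close>

text \<open>The lower index may be negative; only upper indices \<open>a \<ge> 0\<close> are meaningful.\<close>

definition binom :: "int \<Rightarrow> int \<Rightarrow> rat" where
  "binom a b = (if 0 \<le> b \<and> b \<le> a then of_nat (nat a choose nat b) else 0)"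

definition multinom :: "nat set \<Rightarrow> (nat \<Rightarrow> nat) \<Rightarrow> rat" where
  "multinom I m = fact (\<Sum>i\<in>I. m i) / (\<Prod>i\<in>I. fact (m i))"

end

theory Submission
  imports Defs "HOL-Computational_Algebra.Formal_Power_Series" "HOL-Combinatorics.Multiset_Permutations"
begin

text \<open>
  It suffices to compare the two sides after restricting to finitely many variables
  $x_0, \ldots, x_{N-1}$.  Write $s = \sum_a x_a$.  Then $\mathfrak{st}_{k+1} = \sum_a x_a (s - x_a)^k$, and
  $\mathbf{X}_{C_n} = \mathrm{tr}(M^n)$ for the matrix $M_{ac} = [a \neq c]\, x_c$.  As $M$ is a rank-one
  perturbation of a diagonal matrix, with $P(z) = \sum_a x_a z / (1 + x_a z)$ one finds
  \[\sum_n \mathrm{tr}(M^n)\, z^n = \sum_a \frac{1}{1 + x_a z} + \frac{z P'(z)}{1 - P(z)}.\]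
  Expanding in geometric series,
  $1 - P = (1 + s z)^{-1} (1 - B)$ with $B = \sum_{j \ge 2} \mathfrak{st}_j\, z^j (1 + s z)^{1 - j}$, so
  logarithmic differentiation gives
  \[\mathbf{X}_{C_n} = (-1)^n (p_n - \mathfrak{st}_1^n) + \sum_{k \ge 1} \frac{n}{k}\, [z^n] B^k,\]
  and the multinomial theorem yields the coefficients.  The hooks receive an additional contribution from
  $p_n = \sum_r (-1)^r \binom{n-1}{r} \mathfrak{st}_{r+1} \mathfrak{st}_1^{n-1-r}$.  By the same formula the
  products $\mathfrak{st}_\lambda$ span the linearly independent $p_\lambda$, whence they are independent.
\<close>


section \<open>Restriction to finitely many variables\<close>

lemma mcoeff_zero [simp]: "mcoeff 0 M = 0"
  and mcoeff_one: "mcoeff 1 M = (if M = {#} then 1 else 0)"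
  and mcoeff_add [simp]: "mcoeff (f + g) M = mcoeff f M + mcoeff g M"
  and mcoeff_mscale [simp]: "mcoeff (c *\<^sub>Q f) M = c * mcoeff f M"
  and mcoeff_times: "mcoeff (f * g) M = (\<Sum>(A, B)\<in>splits M. mcoeff f A * mcoeff g B)"
  by (simp_all add: zero_mseries_def one_mseries_def plus_mseries_def mscale_def times_mseries_def)

lemma mcoeff_sum [simp]: "mcoeff (\<Sum>i\<in>I. f i) M = (\<Sum>i\<in>I. mcoeff (f i) M)"
  by (induction I rule: infinite_finite_induct) auto

text \<open>Gives access to \<open>span\<close>, \<open>independent\<close> and the exchange bound,
  on which the basis argument rests.\<close>

global_interpretation mser: vector_space mscale
  by unfold_locales
    (auto intro!: mseries_eqI simp: distrib_left distrib_right)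

text \<open>The rationals as a subring: scaling becomes ring multiplication, so power series with
  coefficients in \<open>mseries\<close> can be handled by ring laws alone.\<close>

definition scalar :: "rat \<Rightarrow> mseries" where
  "scalar c = c *\<^sub>Q 1"

lemma mscale_mult_left: "(c *\<^sub>Q f) * g = c *\<^sub>Q (f * g)"
  by (rule mseries_eqI) (simp add: mcoeff_times sum_distrib_left case_prod_unfold mult.assoc)

lemma mscale_eq_scalar: "c *\<^sub>Q f = scalar c * f"
  by (simp add: scalar_def mscale_mult_left)

lemma mscale_mult_right: "f * (c *\<^sub>Q g) = c *\<^sub>Q (f * g)"
  by (simp add: mscale_eq_scalar mult.left_commute)

lemma scalar_add: "scalar (a + b) = scalar a + scalar b"
  and scalar_mult: "scalar (a * b) = scalar a * scalar b"
  and scalar_1 [simp]: "scalar 1 = 1"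
  and scalar_0 [simp]: "scalar 0 = 0"
  and scalar_minus: "scalar (- a) = - scalar a"
  by (simp_all add: scalar_def mser.scale_left_distrib mscale_mult_left)

lemma scalar_of_nat: "scalar (of_nat n) = of_nat n"
  by (induction n) (simp_all add: scalar_add)

lemma scalar_power: "scalar (a ^ n) = scalar a ^ n"
  by (induction n) (simp_all add: scalar_mult)

definition monomial :: "nat multiset \<Rightarrow> mseries" where
  "monomial A = Mseries (\<lambda>M. if M = A then 1 else 0)"

lemma mcoeff_monomial: "mcoeff (monomial A) M = (if M = A then 1 else 0)"
  by (simp add: monomial_def)

text \<open>Only the splitting \<open>(A, M - A)\<close> contributes to the convolution.\<close>

lemma mcoeff_monomial_times:
  "mcoeff (monomial A * f) M = (if A \<subseteq># M then mcoeff f (M - A) else 0)"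
proof -
  have "mcoeff (monomial A * f) M = (\<Sum>p\<in>splits M. if p = (A, M - A) then mcoeff f (M - A) else 0)"
    unfolding mcoeff_times
    by (rule sum.cong) (auto simp: mcoeff_monomial splits_def split: if_splits)
  also have "\<dots> = (if (A, M - A) \<in> splits M then mcoeff f (M - A) else 0)"
    by (simp add: sum.delta)
  also have "(A, M - A) \<in> splits M \<longleftrightarrow> A \<subseteq># M"
    by (auto simp: splits_def)
       (metis mset_subset_eq_add_left)
  finally show ?thesis .
qed

lemma monomial_mult: "monomial A * monomial B = monomial (A + B)"
  by (rule mseries_eqI) (auto simp: mcoeff_monomial_times mcoeff_monomial)

lemma monomial_empty: "monomial {#} = 1"
  by (rule mseries_eqI) (auto simp: mcoeff_monomial mcoeff_one)

definition var :: "nat \<Rightarrow> mseries" where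
  "var i = monomial {#i#}"

lemma var_power: "var i ^ k = monomial (replicate_mset k i)"
  by (induction k) (simp_all add: var_def monomial_empty monomial_mult)

lemma prod_var: "finite V \<Longrightarrow> (\<Prod>v\<in>V. var (\<kappa> v)) = monomial (image_mset \<kappa> (mset_set V))"
  by (induction V rule: finite_induct) (simp_all add: var_def monomial_empty monomial_mult)

section \<open>Truncation: setting all variables from x_N on to zero\<close>

definition trunc :: "nat \<Rightarrow> mseries \<Rightarrow> mseries" where
  "trunc N f = Mseries (\<lambda>M. if set_mset M \<subseteq> {..<N} then mcoeff f M else 0)"

lemma mcoeff_trunc: "mcoeff (trunc N f) M = (if set_mset M \<subseteq> {..<N} then mcoeff f M else 0)"
  by (simp add: trunc_def)

text \<open>A monomial involves finitely many variables, so each coefficient survives in some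
  truncation.\<close>

lemma mseries_eq_trunc:
  assumes "\<And>N. trunc N f = trunc N g"
  shows "f = g"
proof (rule mseries_eqI)
  fix M :: "nat multiset"
  obtain N where "set_mset M \<subseteq> {..<N}"
    using finite_nat_set_iff_bounded[of "set_mset M"] by auto
  then show "mcoeff f M = mcoeff g M"
    by (metis assms mcoeff_trunc)
qed

lemma trunc_add: "trunc N (f + g) = trunc N f + trunc N g"
  and trunc_zero: "trunc N 0 = 0"
  and trunc_mscale: "trunc N (c *\<^sub>Q f) = c *\<^sub>Q trunc N f"
  and trunc_one: "trunc N 1 = 1"
  by (rule mseries_eqI, simp add: mcoeff_trunc mcoeff_one)+

text \<open>All indices of A + B lie below N exactly when those of both A and B do, so a splitting
  is either kept whole or killed.\<close>

lemma trunc_mult: "trunc N (f * g) = trunc N f * trunc N g"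
proof (rule mseries_eqI)
  fix M
  show "mcoeff (trunc N (f * g)) M = mcoeff (trunc N f * trunc N g) M"
  proof (cases "set_mset M \<subseteq> {..<N}")
    case True
    then show ?thesis
      by (auto simp: mcoeff_trunc mcoeff_times splits_def intro!: sum.cong)
  next
    case False
    then have "mcoeff (trunc N f) A * mcoeff (trunc N g) B = 0" if "A + B = M" for A B
      using that by (auto simp: mcoeff_trunc)
    then have "mcoeff (trunc N f * trunc N g) M = 0"
      unfolding mcoeff_times by (intro sum.neutral) (auto simp: splits_def)
    with False show ?thesis by (simp add: mcoeff_trunc)
  qed
qed

lemma trunc_scalar: "trunc N (scalar c) = scalar c"
  by (simp add: scalar_def trunc_mscale trunc_one)

lemma trunc_sum: "trunc N (\<Sum>i\<in>I. f i) = (\<Sum>i\<in>I. trunc N (f i))"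
  by (induction I rule: infinite_finite_induct) (auto simp: trunc_add trunc_zero)

lemma trunc_power: "trunc N (f ^ k) = trunc N f ^ k"
  by (induction k) (auto simp: trunc_one trunc_mult)

lemma trunc_prod_mset: "trunc N (\<Prod>k\<in>#A. f k) = (\<Prod>k\<in>#A. trunc N (f k))"
  by (induction A) (auto simp: trunc_one trunc_mult)

text \<open>With N colors there are finitely many colorings, so the counting definition turns into
  an honest sum of monomials.\<close>

lemma trunc_chromatic:
  assumes "finite (fst G)"
  shows "trunc N (chromatic_sf G) =
    (\<Sum>\<kappa>\<in>{\<kappa> \<in> proper_colorings G. \<kappa> ` fst G \<subseteq> {..<N}}. \<Prod>v\<in>fst G. var (\<kappa> v))"
proof (rule mseries_eqI)
  fix M
  let ?C = "{\<kappa> \<in> proper_colorings G. \<kappa> ` fst G \<subseteq> {..<N}}"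
  have "?C \<subseteq> fst G \<rightarrow>\<^sub>E {..<N}"
    by (auto simp: proper_colorings_def PiE_def)
  then have fin: "finite ?C"
    by (rule finite_subset) (use assms in \<open>intro finite_PiE; auto\<close>)
  have "mcoeff (\<Sum>\<kappa>\<in>?C. \<Prod>v\<in>fst G. var (\<kappa> v)) M =
      (\<Sum>\<kappa>\<in>?C. if image_mset \<kappa> (mset_set (fst G)) = M then 1 else 0)"
    using assms by (auto simp: prod_var mcoeff_monomial intro!: sum.cong)
  also have "\<dots> = of_nat (card {\<kappa> \<in> ?C. image_mset \<kappa> (mset_set (fst G)) = M})"
    using fin by (simp add: sum.If_cases Int_def)
  also have "\<dots> = mcoeff (trunc N (chromatic_sf G)) M"
  proof (cases "set_mset M \<subseteq> {..<N}")
    case True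
    then have "{\<kappa> \<in> ?C. image_mset \<kappa> (mset_set (fst G)) = M} =
       {\<kappa> \<in> proper_colorings G. image_mset \<kappa> (mset_set (fst G)) = M}"
      using assms by (auto simp: subset_iff)
    with True show ?thesis by (simp add: mcoeff_trunc chromatic_sf_def)
  next
    case False
    then have "{\<kappa> \<in> ?C. image_mset \<kappa> (mset_set (fst G)) = M} = {}"
      using assms by (auto simp: image_subset_iff)
    with False show ?thesis unfolding mcoeff_trunc by (simp only: card.empty) simp
  qed
  finally show "mcoeff (trunc N (chromatic_sf G)) M =
      mcoeff (\<Sum>\<kappa>\<in>?C. \<Prod>v\<in>fst G. var (\<kappa> v)) M" ..
qed

text \<open>The power sum p_k, given by coefficients because the sum of all x_i^k is
  infinite.\<close>

definition pow_sf :: "nat \<Rightarrow> mseries" where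
  "pow_sf k = Mseries (\<lambda>M. if \<exists>i. M = replicate_mset k i then 1 else 0)"

lemma trunc_pow:
  assumes "k > 0"
  shows "trunc N (pow_sf k) = (\<Sum>i<N. var i ^ k)"
proof (rule mseries_eqI)
  fix M
  show "mcoeff (trunc N (pow_sf k)) M = mcoeff (\<Sum>i<N. var i ^ k) M"
  proof (cases "\<exists>i. M = replicate_mset k i")
    case True
    then obtain i where i: "M = replicate_mset k i" by blast
    have "mcoeff (\<Sum>i<N. var i ^ k) M = (\<Sum>j<N. if j = i then 1 else 0)"
      unfolding mcoeff_sum using assms
      by (intro sum.cong) (auto simp: var_power mcoeff_monomial i replicate_mset_eq_iff)
    then show ?thesis using i assms by (auto simp: mcoeff_trunc pow_sf_def)
  next
    case False
    then show ?thesis by (auto simp: mcoeff_trunc pow_sf_def var_power mcoeff_monomial)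
  qed
qed

text \<open>Once the center has color a, each of the k leaves independently takes any other color,
  which contributes a factor s - x_a.\<close>

lemma trunc_star:
  "trunc N (star_sf (Suc k)) = (\<Sum>a<N. var a * ((\<Sum>i<N. var i) - var a) ^ k)"
proof -
  let ?G = "star_graph (Suc k)"
  let ?I = "{1..<Suc k}"
  let ?F = "\<lambda>a. ?I \<rightarrow>\<^sub>E ({..<N} - {a})"
  have V: "fst ?G = insert 0 ?I"
    by (auto simp: star_graph_def)
  have "(\<Sum>a<N. var a * ((\<Sum>i<N. var i) - var a) ^ k) =
      (\<Sum>a<N. var a * (\<Prod>i\<in>?I. \<Sum>c\<in>{..<N} - {a}. var c))"
    by (intro sum.cong) (auto simp: sum_diff1)
  also have "\<dots> = (\<Sum>a<N. \<Sum>f\<in>?F a. var a * (\<Prod>i\<in>?I. var (f i)))"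
    by (subst prod_sum_PiE) (auto simp: sum_distrib_left)
  also have "\<dots> = (\<Sum>(a, f)\<in>Sigma {..<N} ?F. var a * (\<Prod>i\<in>?I. var (f i)))"
    by (subst sum.Sigma) (auto intro!: finite_PiE)
  also have "\<dots> = (\<Sum>\<kappa>\<in>{\<kappa> \<in> proper_colorings ?G. \<kappa> ` fst ?G \<subseteq> {..<N}}. \<Prod>v\<in>fst ?G. var (\<kappa> v))"
  \<comment> \<open>A coloring is cut into the color of the center and the coloring of the leaves;
    the value at 0 is reset to \<open>undefined\<close> to keep the latter extensional.\<close>
  proof (rule sum.reindex_bij_witness[where i = "\<lambda>\<kappa>. (\<kappa> 0, \<kappa>(0 := undefined))"
        and j = "\<lambda>(a, f). f(0 := a)"])
    fix p assume p: "p \<in> Sigma {..<N} ?F"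
    obtain a f where [simp]: "p = (a, f)" by (cases p)
    from p have a: "a < N" and f: "f \<in> ?F a" by auto
    have f0: "f 0 = undefined" using f by (auto simp: PiE_def extensional_def)
    show "(\<lambda>\<kappa>. (\<kappa> 0, \<kappa>(0 := undefined))) (case p of (a, f) \<Rightarrow> f(0 := a)) = p"
      using f0 by (auto simp: fun_eq_iff)
    have fI: "f i < N" "f i \<noteq> a" if "1 \<le> i" "i < Suc k" for i
      using f that by (auto simp: PiE_def Pi_def)
    have fe: "f i = undefined" if "i \<ge> Suc k" for i
      using f that by (auto simp: PiE_def extensional_def)
    have "f(0 := a) \<in> fst ?G \<rightarrow>\<^sub>E {..<N}"
      unfolding V using fI a fe by (auto simp: PiE_def Pi_def extensional_def)
    moreover have "(f(0 := a)) u \<noteq> (f(0 := a)) v" if uv: "{u, v} \<in> snd ?G" for u v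
    proof -
      from uv obtain i where i: "{u, v} = {0, i}" "1 \<le> i" "i < Suc k"
        by (auto simp: star_graph_def)
      then show ?thesis using fI[of i] by (auto simp: doubleton_eq_iff)
    qed
    ultimately show "(case p of (a, f) \<Rightarrow> f(0 := a)) \<in> {\<kappa> \<in> proper_colorings ?G. \<kappa> ` fst ?G \<subseteq> {..<N}}"
      unfolding proper_colorings_def by (fastforce simp: PiE_def Pi_iff)
    have "(\<Prod>v\<in>?I. var ((f(0 := a)) v)) = (\<Prod>v\<in>?I. var (f v))"
      by (intro prod.cong) auto
    then show "(\<Prod>v\<in>fst ?G. var ((case p of (a, f) \<Rightarrow> f(0 := a)) v)) =
        (case p of (a, f) \<Rightarrow> var a * (\<Prod>i\<in>?I. var (f i)))"
      unfolding V by simp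
  next
    fix \<kappa> assume k: "\<kappa> \<in> {\<kappa> \<in> proper_colorings ?G. \<kappa> ` fst ?G \<subseteq> {..<N}}"
    show "(case (\<kappa> 0, \<kappa>(0 := undefined)) of (a, f) \<Rightarrow> f(0 := a)) = \<kappa>"
      by simp
    have "\<kappa> 0 \<noteq> \<kappa> i" if "1 \<le> i" "i < Suc k" for i
      using k that by (auto simp: proper_colorings_def star_graph_def)
    then have "\<kappa> i \<noteq> \<kappa> 0" if "1 \<le> i" "i < Suc k" for i
      using that by metis
    with k show "(\<kappa> 0, \<kappa>(0 := undefined)) \<in> Sigma {..<N} ?F"
      by (auto simp: V proper_colorings_def PiE_def Pi_def extensional_def image_subset_iff)
  qed
  also have "\<dots> = trunc N (star_sf (Suc k))"
    unfolding star_sf_def by (rule trunc_chromatic[symmetric]) (simp add: V)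
  finally show ?thesis ..
qed

text \<open>Write x_a^(k+1) = x_a (s - (s - x_a))^k, expand by the binomial theorem and sum over a;
  the sum of x_a (s - x_a)^r is the star on r + 1 vertices.\<close>

lemma pow_sf_eq_star:
  "pow_sf (Suc k) = (\<Sum>r\<le>k. scalar ((-1) ^ r * of_nat (k choose r)) * (star_sf (Suc r) * star_sf 1 ^ (k - r)))"
proof (rule mseries_eq_trunc)
  fix N
  define s where "s = (\<Sum>i<N. var i)"
  have s1: "trunc N (star_sf 1) = s"
    using trunc_star[of N 0] by (simp add: s_def)
  have "trunc N (pow_sf (Suc k)) = (\<Sum>a<N. var a * (- (s - var a) + s) ^ k)"
    by (simp add: trunc_pow)
  also have "\<dots> = (\<Sum>a<N. \<Sum>r\<le>k. var a * (of_nat (k choose r) * (- (s - var a)) ^ r * s ^ (k - r)))"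
    by (simp only: binomial_ring sum_distrib_left)
  also have "\<dots> = (\<Sum>r\<le>k. \<Sum>a<N. scalar ((-1) ^ r * of_nat (k choose r)) * ((var a * (s - var a) ^ r) * s ^ (k - r)))"
    apply (subst sum.swap)
    apply (intro sum.cong refl)
    apply (subst power_minus)
    apply (simp add: scalar_mult scalar_of_nat scalar_power scalar_minus mult_ac)
    done
  also have "\<dots> = trunc N (\<Sum>r\<le>k. scalar ((-1) ^ r * of_nat (k choose r)) * (star_sf (Suc r) * star_sf 1 ^ (k - r)))"
    unfolding trunc_sum trunc_mult trunc_power s1
    by (simp add: trunc_star trunc_scalar s_def[symmetric]
       sum_distrib_left sum_distrib_right del: One_nat_def)
  finally show "trunc N (pow_sf (Suc k)) =
    trunc N (\<Sum>r\<le>k. scalar ((-1) ^ r * of_nat (k choose r)) * (star_sf (Suc r) * star_sf 1 ^ (k - r)))" .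
qed


section \<open>Linear independence of the star products\<close>

definition pow_sf_partition :: "nat multiset \<Rightarrow> mseries" where
  "pow_sf_partition \<mu> = (\<Prod>k\<in>#\<mu>. pow_sf k)"

text \<open>The exponent partition of a monomial, forgetting which variables carry the
  exponents.\<close>

definition exponents :: "nat multiset \<Rightarrow> nat multiset" where
  "exponents M = image_mset (count M) (mset_set (set_mset M))"

lemma size_exponents: "size (exponents M) = card (set_mset M)"
  by (simp add: exponents_def)

lemma exponents_add_fresh:
  assumes "i \<notin># A" "k > 0"
  shows "exponents (A + replicate_mset k i) = add_mset k (exponents A)"
proof -
  have "set_mset (A + replicate_mset k i) = insert i (set_mset A)"
    using assms by auto
  moreover have "image_mset (count (A + replicate_mset k i)) (mset_set (set_mset A)) =
      image_mset (count A) (mset_set (set_mset A))"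
    using assms by (intro image_mset_cong) auto
  ultimately show ?thesis
    using assms by (simp add: exponents_def not_in_iff)
qed

lemma mcoeff_pow_sf_nonneg: "mcoeff (pow_sf k) M \<ge> 0"
  by (simp add: pow_sf_def)

text \<open>Excludes cancellation, so that a single splitting already makes a coefficient positive
  in \<open>exists_exponents\<close>.\<close>

lemma mcoeff_pow_sf_partition_nonneg: "mcoeff (pow_sf_partition \<mu>) M \<ge> 0"
proof (induction \<mu> arbitrary: M)
  case empty
  then show ?case by (simp add: pow_sf_partition_def mcoeff_one)
next
  case (add k \<mu>)
  then show ?case
    by (auto simp: pow_sf_partition_def mcoeff_times mcoeff_pow_sf_nonneg intro!: sum_nonneg)
qed

text \<open>Triangularity of the power sum products with respect to the monomials, ordered by length.\<close>

lemma exponents_of_pow_sf_partition: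
  assumes "0 \<notin># \<mu>" "mcoeff (pow_sf_partition \<mu>) M \<noteq> 0"
  shows "size (exponents M) \<le> size \<mu> \<and> (size (exponents M) = size \<mu> \<longrightarrow> exponents M = \<mu>)"
  using assms
proof (induction \<mu> arbitrary: M)
  case empty
  then show ?case
    by (auto simp: pow_sf_partition_def mcoeff_one exponents_def split: if_splits)
next
  case (add k \<mu>)
  have "(\<Sum>(A, B)\<in>splits M. mcoeff (pow_sf k) A * mcoeff (pow_sf_partition \<mu>) B) \<noteq> 0"
    using add.prems by (simp add: pow_sf_partition_def mcoeff_times)
  then obtain A B where AB: "A + B = M" "mcoeff (pow_sf k) A \<noteq> 0" "mcoeff (pow_sf_partition \<mu>) B \<noteq> 0"
    by (rule sum.not_neutral_contains_not_neutral) (auto simp: splits_def)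
  from AB obtain i where "A = replicate_mset k i"
    by (auto simp: pow_sf_def split: if_splits)
  with AB have M: "M = B + replicate_mset k i" by (simp add: add.commute)
  have k: "k > 0" using add.prems by auto
  have IH: "size (exponents B) \<le> size \<mu>" "size (exponents B) = size \<mu> \<Longrightarrow> exponents B = \<mu>"
    using add.IH[of B] add.prems AB by auto
  show ?case
  \<comment> \<open>Multiplying by x_i^k either enlarges an exponent already present, so that the
    number of variables drops below the length, or creates the new part k.\<close>
  proof (cases "i \<in># B")
    case True
    then have "set_mset M = set_mset B" using M by (auto split: if_splits)
    with IH show ?thesis by (simp add: size_exponents)
  next
    case False
    then show ?thesis using IH M k exponents_add_fresh[of i B k] by auto
  qed
qed

text \<open>Give each part its own fresh variable.\<close>

lemma exists_exponents:
  assumes "0 \<notin># \<mu>"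
  shows "\<exists>M. exponents M = \<mu> \<and> mcoeff (pow_sf_partition \<mu>) M > 0"
  using assms
proof (induction \<mu>)
  case empty
  show ?case
    by (rule exI[of _ "{#}"]) (simp add: exponents_def pow_sf_partition_def mcoeff_one)
next
  case (add k \<mu>)
  then obtain M where M: "exponents M = \<mu>" "mcoeff (pow_sf_partition \<mu>) M > 0"
    by auto
  obtain i where i: "i \<notin># M"
    using ex_new_if_finite[OF infinite_UNIV_nat, of "set_mset M"] by auto
  have k: "k > 0" using add.prems by auto
  let ?R = "replicate_mset k i"
  let ?t = "\<lambda>p. mcoeff (pow_sf k) (fst p) * mcoeff (pow_sf_partition \<mu>) (snd p)"
  have "0 < ?t (?R, M)"
    using M by (auto simp: pow_sf_def)
  also have "\<dots> \<le> (\<Sum>p\<in>splits (M + ?R). ?t p)"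
    by (rule member_le_sum)
      (auto simp: mcoeff_pow_sf_nonneg mcoeff_pow_sf_partition_nonneg, simp add: splits_def)
  also have "\<dots> = mcoeff (pow_sf_partition (add_mset k \<mu>)) (M + ?R)"
    by (simp add: pow_sf_partition_def mcoeff_times case_prod_unfold)
  finally show ?case
    using M exponents_add_fresh[OF i k] by auto
qed

text \<open>Take a longest \<nu> with nonzero coefficient. By triangularity its monomial with
  distinct variables occurs in no other product of at most that length, so its coefficient cannot
  cancel.\<close>

lemma pow_sf_partition_lin_indep:
  assumes "(\<Sum>\<mu>\<in>partitions n. b \<mu> *\<^sub>Q pow_sf_partition \<mu>) = 0" "\<mu> \<in> partitions n"
  shows "b \<mu> = 0"
proof (rule ccontr)
  assume "b \<mu> \<noteq> 0"
  define S where "S = {\<mu> \<in> partitions n. b \<mu> \<noteq> 0}"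
  have "finite S" "S \<noteq> {}"
    using assms \<open>b \<mu> \<noteq> 0\<close> by (auto simp: S_def finite_partitions)
  then have "Max (size ` S) \<in> size ` S" "\<And>\<rho>. \<rho> \<in> S \<Longrightarrow> size \<rho> \<le> Max (size ` S)"
    by (auto intro: Max_in)
  then obtain \<nu> where \<nu>: "\<nu> \<in> S" "\<And>\<rho>. \<rho> \<in> S \<Longrightarrow> size \<rho> \<le> size \<nu>"
    by auto
  then have P: "\<nu> \<in> partitions n" and "b \<nu> \<noteq> 0" "0 \<notin># \<nu>"
    by (auto simp: S_def partitions_def)
  then obtain M where M: "exponents M = \<nu>" "mcoeff (pow_sf_partition \<nu>) M > 0"
    using exists_exponents by blast
  have "b \<rho> * mcoeff (pow_sf_partition \<rho>) M = 0" if \<rho>: "\<rho> \<in> partitions n - {\<nu>}" for \<rho>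
  proof (rule ccontr)
    assume *: "b \<rho> * mcoeff (pow_sf_partition \<rho>) M \<noteq> 0"
    then have "size \<rho> \<le> size \<nu>" using \<rho> \<nu> by (auto simp: S_def)
    moreover have "0 \<notin># \<rho>" using \<rho> by (auto simp: partitions_def)
    ultimately have "\<rho> = \<nu>"
      using * exponents_of_pow_sf_partition[of \<rho> M] M by auto
    with \<rho> show False by simp
  qed
  then have "\<forall>\<rho>\<in>partitions n - {\<nu>}. b \<rho> * mcoeff (pow_sf_partition \<rho>) M = 0"
    by blast
  then have "(\<Sum>\<rho>\<in>partitions n. b \<rho> * mcoeff (pow_sf_partition \<rho>) M) =
      b \<nu> * mcoeff (pow_sf_partition \<nu>) M"
    by (subst sum.remove[OF finite_partitions P]) (simp only: sum.neutral add_0_right)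
  moreover have "(\<Sum>\<rho>\<in>partitions n. b \<rho> * mcoeff (pow_sf_partition \<rho>) M) = 0"
    using arg_cong[OF assms(1), of "\<lambda>f. mcoeff f M"] by (simp only: mcoeff_sum mcoeff_mscale mcoeff_zero)
  ultimately show False using M \<open>b \<nu> \<noteq> 0\<close> by simp
qed

text \<open>\<open>independent\<close> speaks of a set of vectors and would not notice repetitions,
  so injectivity of the indexing is established separately: a repetition is a linear relation with
  coefficients 1 and -1.\<close>

lemma inj_on_pow_sf_partition: "inj_on pow_sf_partition (partitions n)"
proof (rule inj_onI, rule ccontr)
  fix \<mu> \<nu>
  assume *: "\<mu> \<in> partitions n" "\<nu> \<in> partitions n" "pow_sf_partition \<mu> = pow_sf_partition \<nu>" "\<mu> \<noteq> \<nu>"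
  define b :: "nat multiset \<Rightarrow> rat" where "b = (\<lambda>\<rho>. if \<rho> = \<mu> then 1 else if \<rho> = \<nu> then - 1 else 0)"
  have "(\<Sum>\<rho>\<in>partitions n. b \<rho> *\<^sub>Q pow_sf_partition \<rho>) =
      (\<Sum>\<rho>\<in>{\<mu>, \<nu>}. b \<rho> *\<^sub>Q pow_sf_partition \<rho>)"
    using * by (intro sum.mono_neutral_right finite_partitions) (auto simp: b_def)
  also have "\<dots> = 0" using * by (simp add: b_def)
  finally have "b \<mu> = 0" using * pow_sf_partition_lin_indep by blast
  then show False by (simp add: b_def)
qed

lemma independent_pow_sf: "mser.independent (pow_sf_partition ` partitions n)"
proof (rule mser.independent_if_scalars_zero)
  fix f and x assume f: "(\<Sum>x\<in>pow_sf_partition ` partitions n. f x *\<^sub>Q x) = 0"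
    and "x \<in> pow_sf_partition ` partitions n"
  then obtain \<mu> where \<mu>: "\<mu> \<in> partitions n" "x = pow_sf_partition \<mu>" by auto
  have "(\<Sum>\<mu>\<in>partitions n. f (pow_sf_partition \<mu>) *\<^sub>Q pow_sf_partition \<mu>) = 0"
    using f by (simp add: sum.reindex[OF inj_on_pow_sf_partition])
  then show "f x = 0"
    using pow_sf_partition_lin_indep[of "\<lambda>\<mu>. f (pow_sf_partition \<mu>)" n \<mu>] \<mu> by simp
qed (simp add: finite_partitions)

section \<open>Power sum products lie in the span of the star products\<close>

lemma partitions_add:
  "\<mu> \<in> partitions m \<Longrightarrow> \<nu> \<in> partitions n \<Longrightarrow> \<mu> + \<nu> \<in> partitions (m + n)"
  by (auto simp: partitions_def)

lemma star_sf_partition_union: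
  "star_sf_partition (\<mu> + \<nu>) = star_sf_partition \<mu> * star_sf_partition \<nu>"
  by (simp add: star_sf_partition_def)

text \<open>Bilinearity reduces this to generators, and the product of two star products is the star
  product of the united partition.\<close>

lemma span_star_times:
  assumes "f \<in> mser.span (star_sf_partition ` partitions m)"
    and "g \<in> mser.span (star_sf_partition ` partitions n)"
  shows "f * g \<in> mser.span (star_sf_partition ` partitions (m + n))" (is "_ \<in> mser.span ?S")
proof -
  have *: "star_sf_partition \<mu> * g \<in> mser.span ?S" if "\<mu> \<in> partitions m" for \<mu>
    using assms(2)
  proof (induction rule: mser.span_induct_alt)
    case base
    show ?case by (simp add: mser.span_zero)
  next
    case (step c x y)
    then obtain \<nu> where "\<nu> \<in> partitions n" "x = star_sf_partition \<nu>" by auto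
    then have "star_sf_partition \<mu> * x \<in> mser.span ?S"
      using that by (auto intro!: mser.span_base imageI partitions_add simp flip: star_sf_partition_union)
    with step show ?case
      by (simp add: distrib_left mscale_mult_right mser.span_add mser.span_scale)
  qed
  show ?thesis using assms(1)
  proof (induction rule: mser.span_induct_alt)
    case base
    show ?case by (simp add: mser.span_zero)
  next
    case (step c x y)
    then have "x * g \<in> mser.span ?S" using * by auto
    with step show ?case
      by (simp add: distrib_right mscale_mult_left mser.span_add mser.span_scale)
  qed
qed

lemma pow_sf_in_span_star:
  assumes "k > 0"
  shows "pow_sf k \<in> mser.span (star_sf_partition ` partitions k)"
proof -
  obtain m where k: "k = Suc m" using assms gr0_implies_Suc by blast
  have "star_sf (Suc r) * star_sf 1 ^ (m - r) \<in> star_sf_partition ` partitions k" if "r \<le> m" for r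
  proof (rule image_eqI)
    show "star_sf (Suc r) * star_sf 1 ^ (m - r) =
        star_sf_partition (add_mset (Suc r) (replicate_mset (m - r) 1))"
      by (simp add: star_sf_partition_def)
    show "add_mset (Suc r) (replicate_mset (m - r) 1) \<in> partitions k"
      using that by (auto simp: partitions_def k sum_mset_replicate_mset split: if_splits)
  qed
  then show ?thesis
    unfolding k pow_sf_eq_star
    by (intro mser.span_sum) (simp add: mser.span_base mser.span_scale flip: mscale_eq_scalar)
qed

lemma pow_sf_partition_in_span_star:
  assumes "0 \<notin># \<mu>"
  shows "pow_sf_partition \<mu> \<in> mser.span (star_sf_partition ` partitions (sum_mset \<mu>))"
  using assms
proof (induction \<mu>)
  case empty
  have "(1::mseries) = star_sf_partition {#}" by (simp add: star_sf_partition_def)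
  moreover have "{#} \<in> partitions 0" by (simp add: partitions_def)
  ultimately have "1 \<in> star_sf_partition ` partitions 0" by blast
  then show ?case by (simp add: pow_sf_partition_def mser.span_base)
next
  case (add k \<mu>)
  then show ?case
    using span_star_times[OF pow_sf_in_span_star[of k] add.IH]
    by (simp add: pow_sf_partition_def)
qed

text \<open>Comparing cardinalities with the independent family of power sums, which the stars span.\<close>

lemma star_sf_partition_basis:
  "mser.independent (star_sf_partition ` partitions n)" "inj_on star_sf_partition (partitions n)"
proof -
  let ?P = "pow_sf_partition ` partitions n" and ?S = "star_sf_partition ` partitions n"
  have fin: "finite ?S" by (simp add: finite_partitions)
  \<comment> \<open>A maximal independent set of star products. It spans all of them, hence also the
    power sum products, whose number therefore bounds its size from below.\<close>
  obtain D where D: "D \<subseteq> ?S" "mser.independent D" "?S \<subseteq> mser.span D"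
    using mser.maximal_independent_subset[of ?S] by auto
  have finD: "finite D" using D fin finite_subset by blast
  have "?P \<subseteq> mser.span ?S"
    using pow_sf_partition_in_span_star by (auto simp: partitions_def)
  also have "\<dots> \<subseteq> mser.span D"
    using D by (simp add: mser.span_minimal)
  finally have "card ?P \<le> card D"
    using mser.independent_span_bound[OF finD independent_pow_sf] by blast
  moreover have "card ?P = card (partitions n)"
    by (rule card_image[OF inj_on_pow_sf_partition])
  moreover have "card D \<le> card ?S" using D fin by (simp add: card_mono)
  moreover have "card ?S \<le> card (partitions n)" by (simp add: card_image_le finite_partitions)
  \<comment> \<open>The inequalities close up to a cycle: no star product was discarded and none
    coincide.\<close>
  ultimately have "card D = card ?S" "card ?S = card (partitions n)" by linarith+
  then have "D = ?S" "inj_on star_sf_partition (partitions n)"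
    using D fin finite_partitions by (auto simp: card_subset_eq eq_card_imp_inj_on)
  with D show "mser.independent ?S" "inj_on star_sf_partition (partitions n)" by auto
qed

lemma star_expansion_unique:
  assumes "is_star_expansion n f c" "is_star_expansion n f d" "\<mu> \<in> partitions n"
  shows "c \<mu> = d \<mu>"
proof -
  let ?P = "partitions n"
  \<comment> \<open>Independence wants coefficients indexed by vectors, so the difference of the two
    expansions is transported along the injective indexing.\<close>
  let ?g = "\<lambda>x. c (inv_into ?P star_sf_partition x) - d (inv_into ?P star_sf_partition x)"
  have "(\<Sum>x\<in>star_sf_partition ` ?P. ?g x *\<^sub>Q x) =
      (\<Sum>\<mu>\<in>?P. (c \<mu> - d \<mu>) *\<^sub>Q star_sf_partition \<mu>)"
    using star_sf_partition_basis(2)[of n] by (subst sum.reindex) (auto intro!: sum.cong)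
  also have "\<dots> = 0"
    using assms(1,2) by (simp add: is_star_expansion_def mser.scale_left_diff_distrib sum_subtractf)
  finally have "?g (star_sf_partition \<mu>) = 0"
    using mser.independentD[OF star_sf_partition_basis(1)[of n] _ subset_refl, of ?g]
    by (simp add: assms(3) finite_partitions)
  then show ?thesis
    using star_sf_partition_basis(2)[of n] assms(3) by simp
qed


section \<open>Cycle colorings as closed walks\<close>

text \<open>The (a, b) entry of the n-th power of the matrix with entry x_c at (c, b) for c \<noteq>
  b and zero diagonal. This is the transpose of M, which has the same traces. A walk is weighted by
  all its vertices except the last.\<close>

primrec walk :: "(nat \<Rightarrow> 'a) \<Rightarrow> nat \<Rightarrow> nat \<Rightarrow> nat \<Rightarrow> nat \<Rightarrow> 'a::comm_ring_1" where
  "walk x N 0 a b = (if a = b then 1 else 0)"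
| "walk x N (Suc n) a b = (\<Sum>c\<in>{..<N} - {b}. walk x N n a c * x c)"

definition path_colorings :: "nat \<Rightarrow> nat \<Rightarrow> nat \<Rightarrow> (nat \<Rightarrow> nat) set" where
  "path_colorings N n a = {\<kappa> \<in> {..<n} \<rightarrow>\<^sub>E {..<N}. \<kappa> 0 = a \<and> (\<forall>i. Suc i < n \<longrightarrow> \<kappa> i \<noteq> \<kappa> (Suc i))}"

lemma finite_path_colorings [simp]: "finite (path_colorings N n a)"
  by (rule finite_subset[of _ "{..<n} \<rightarrow>\<^sub>E {..<N}"]) (auto simp: path_colorings_def intro!: finite_PiE)

text \<open>Induction on the last vertex of the path. The endpoint b carries no weight and only
  forbids a color at the end, so that b = a will close the cycle.\<close>

lemma walk_path_colorings:
  assumes "a < N"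
  shows "(\<Sum>\<kappa>\<in>{\<kappa> \<in> path_colorings N (Suc n) a. \<kappa> n \<noteq> b}. \<Prod>i<Suc n. x (\<kappa> i)) = walk x N (Suc n) a b"
proof (induction n arbitrary: b)
  case 0
  let ?k = "\<lambda>i::nat. if i = 0 then a else undefined"
  have "path_colorings N (Suc 0) a = {?k}"
  proof (intro equalityI subsetI)
    fix \<kappa> assume "\<kappa> \<in> path_colorings N (Suc 0) a"
    then have "\<kappa> i = ?k i" for i
      by (auto simp: path_colorings_def PiE_def extensional_def)
    then show "\<kappa> \<in> {?k}" by auto
  qed (use assms in \<open>auto simp: path_colorings_def PiE_def extensional_def\<close>)
  then have "{\<kappa> \<in> path_colorings N (Suc 0) a. \<kappa> 0 \<noteq> b} = (if a = b then {} else {?k})"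
    by auto
  moreover have "walk x N (Suc 0) a b = (\<Sum>c\<in>{..<N} - {b}. if a = c then x c else 0)"
    unfolding walk.simps by (intro sum.cong) auto
  ultimately show ?case using assms by (auto simp del: walk.simps)
next
  case (Suc n)
  let ?Q = "\<lambda>c. {\<kappa> \<in> path_colorings N (Suc n) a. \<kappa> n \<noteq> c}"
  have "walk x N (Suc (Suc n)) a b =
      (\<Sum>c\<in>{..<N} - {b}. (\<Sum>\<kappa>\<in>?Q c. \<Prod>i<Suc n. x (\<kappa> i)) * x c)"
    by (simp only: walk.simps(2)[of x N "Suc n"] Suc.IH)
  also have "\<dots> = (\<Sum>(c, \<kappa>)\<in>Sigma ({..<N} - {b}) ?Q. (\<Prod>i<Suc n. x (\<kappa> i)) * x c)"
    unfolding sum_distrib_right by (subst sum.Sigma) auto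
  also have "\<dots> = (\<Sum>\<kappa>\<in>{\<kappa> \<in> path_colorings N (Suc (Suc n)) a. \<kappa> (Suc n) \<noteq> b}. \<Prod>i<Suc (Suc n). x (\<kappa> i))"
  \<comment> \<open>The last vertex is removed from the coloring, its color c becoming the endpoint
    of the shorter walk.\<close>
  proof (rule sum.reindex_bij_witness[where i = "\<lambda>\<kappa>. (\<kappa> (Suc n), \<kappa>(Suc n := undefined))"
        and j = "\<lambda>(c, \<kappa>). \<kappa>(Suc n := c)"])
    fix p assume p: "p \<in> Sigma ({..<N} - {b}) ?Q"
    obtain c \<kappa> where [simp]: "p = (c, \<kappa>)" by (cases p)
    from p have c: "c < N" "c \<noteq> b" "\<kappa> n \<noteq> c" and k: "\<kappa> \<in> path_colorings N (Suc n) a" by auto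
    have "\<kappa> (Suc n) = undefined"
      using k by (auto simp: path_colorings_def PiE_def extensional_def)
    then show "(\<lambda>\<kappa>. (\<kappa> (Suc n), \<kappa>(Suc n := undefined))) (case p of (c, \<kappa>) \<Rightarrow> \<kappa>(Suc n := c)) = p"
      by (auto simp: fun_eq_iff)
    show "(case p of (c, \<kappa>) \<Rightarrow> \<kappa>(Suc n := c)) \<in> {\<kappa> \<in> path_colorings N (Suc (Suc n)) a. \<kappa> (Suc n) \<noteq> b}"
      using k c by (auto simp: path_colorings_def PiE_def Pi_def extensional_def less_Suc_eq)
    have "(\<Prod>i<Suc n. x ((\<kappa>(Suc n := c)) i)) = (\<Prod>i<Suc n. x (\<kappa> i))"
      by (intro prod.cong) auto
    then show "(\<Prod>i<Suc (Suc n). x ((case p of (c, \<kappa>) \<Rightarrow> \<kappa>(Suc n := c)) i)) =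
        (case p of (c, \<kappa>) \<Rightarrow> (\<Prod>i<Suc n. x (\<kappa> i)) * x c)"
      by (simp only: prod.lessThan_Suc[of _ "Suc n"] \<open>p = (c, \<kappa>)\<close> prod.case) simp
  next
    fix \<kappa> assume k: "\<kappa> \<in> {\<kappa> \<in> path_colorings N (Suc (Suc n)) a. \<kappa> (Suc n) \<noteq> b}"
    show "(case (\<kappa> (Suc n), \<kappa>(Suc n := undefined)) of (c, \<kappa>) \<Rightarrow> \<kappa>(Suc n := c)) = \<kappa>"
      by simp
    have "\<kappa> i < N" if "i < Suc (Suc n)" for i
      using k that by (auto simp: path_colorings_def PiE_def Pi_def)
    moreover have "\<kappa> i \<noteq> \<kappa> (Suc i)" if "i < Suc n" for i
      using k that by (auto simp: path_colorings_def)
    moreover have "\<kappa> i = undefined" if "i \<ge> Suc (Suc n)" for i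
      using k that by (auto simp: path_colorings_def PiE_def extensional_def)
    ultimately show "(\<kappa> (Suc n), \<kappa>(Suc n := undefined)) \<in> Sigma ({..<N} - {b}) ?Q"
      using k by (auto simp: path_colorings_def PiE_def Pi_def extensional_def less_Suc_eq_le le_Suc_eq)
  qed
  finally show ?case ..
qed

text \<open>Cut the cycle at the edge between n - 1 and 0 and sort by the color of 0.\<close>

lemma cycle_colorings:
  assumes "n \<ge> 2"
  shows "{\<kappa> \<in> proper_colorings (cycle_graph n). \<kappa> ` {..<n} \<subseteq> {..<N}} =
    (\<Union>a<N. {\<kappa> \<in> path_colorings N n a. \<kappa> (n - 1) \<noteq> a})" (is "?L = ?R")
proof (intro equalityI subsetI)
  fix \<kappa> assume k: "\<kappa> \<in> ?L"
  then have "\<kappa> \<in> {..<n} \<rightarrow>\<^sub>E {..<N}"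
    by (auto simp: proper_colorings_def cycle_graph_def PiE_def)
  moreover have *: "\<kappa> i \<noteq> \<kappa> ((i + 1) mod n)" if "i < n" for i
    using k that by (auto simp: proper_colorings_def cycle_graph_def)
  have "\<kappa> i \<noteq> \<kappa> (Suc i)" if "Suc i < n" for i
    using *[of i] that by simp
  moreover have "\<kappa> (n - 1) \<noteq> \<kappa> 0"
    using *[of "n - 1"] assms by simp
  moreover have "\<kappa> 0 < N" using k assms by (auto simp: image_subset_iff)
  ultimately show "\<kappa> \<in> ?R" by (auto simp: path_colorings_def)
next
  fix \<kappa> assume k: "\<kappa> \<in> ?R"
  then have K: "\<kappa> \<in> {..<n} \<rightarrow>\<^sub>E {..<N}" "\<kappa> (n - 1) \<noteq> \<kappa> 0" "\<And>i. Suc i < n \<Longrightarrow> \<kappa> i \<noteq> \<kappa> (Suc i)"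
    by (auto simp: path_colorings_def)
  have *: "\<kappa> i \<noteq> \<kappa> ((i + 1) mod n)" if "i < n" for i
  proof (cases "Suc i = n")
    case True
    then show ?thesis using K(2) by auto
  next
    case False
    then show ?thesis using K(3)[of i] that by simp
  qed
  have "\<kappa> u \<noteq> \<kappa> v" if "{u, v} \<in> snd (cycle_graph n)" for u v
  proof -
    from that obtain i where "i < n" "{u, v} = {i, (i + 1) mod n}"
      by (auto simp: cycle_graph_def)
    then show ?thesis using *[of i] by (auto simp: doubleton_eq_iff)
  qed
  with K(1) show "\<kappa> \<in> ?L"
    by (auto simp: proper_colorings_def cycle_graph_def PiE_def)
qed

lemma trunc_cycle:
  assumes "n \<ge> 2"
  shows "trunc N (chromatic_sf (cycle_graph n)) = (\<Sum>a<N. walk var N n a a)"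
proof -
  obtain m where m: "n = Suc m" using assms not0_implies_Suc by force
  have V: "fst (cycle_graph n) = {..<n}" by (simp add: cycle_graph_def)
  have "trunc N (chromatic_sf (cycle_graph n)) =
      (\<Sum>\<kappa>\<in>(\<Union>a<N. {\<kappa> \<in> path_colorings N n a. \<kappa> (n - 1) \<noteq> a}). \<Prod>i<n. var (\<kappa> i))"
    using trunc_chromatic[of "cycle_graph n" N] cycle_colorings[OF assms, of N] by (simp only: V finite_lessThan)
  also have "\<dots> = (\<Sum>a<N. \<Sum>\<kappa>\<in>{\<kappa> \<in> path_colorings N n a. \<kappa> (n - 1) \<noteq> a}. \<Prod>i<n. var (\<kappa> i))"
    by (rule sum.UNION_disjoint) (simp, simp, auto simp: path_colorings_def)
  also have "\<dots> = (\<Sum>a<N. walk var N n a a)"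
    by (intro sum.cong) (auto simp: m walk_path_colorings simp del: walk.simps prod.lessThan_Suc)
  finally show ?thesis .
qed


section \<open>Generating functions\<close>

lemma fps_const_sum: "fps_const (\<Sum>i\<in>A. f i) = (\<Sum>i\<in>A. fps_const (f i))"
  by (induction A rule: infinite_finite_induct) (simp_all flip: fps_const_add)

text \<open>The series 1 / (1 + a z), given by coefficients because the coefficient ring is not a
  field.\<close>

definition geo :: "'a::comm_ring_1 \<Rightarrow> 'a fps" where
  "geo a = Abs_fps (\<lambda>n. (- a) ^ n)"

lemma fps_nth_geo [simp]: "fps_nth (geo a) n = (- a) ^ n"
  by (simp add: geo_def)

lemma geo_inverse: "(1 + fps_const a * fps_X) * geo a = 1"
proof (rule fps_ext)
  fix n show "fps_nth ((1 + fps_const a * fps_X) * geo a) n = fps_nth 1 n"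
    by (cases n) (simp_all add: distrib_right mult.assoc)
qed

lemma geo_eq: "fps_const a * fps_X * geo a = 1 - geo a"
  using geo_inverse[of a] by (simp add: algebra_simps)

lemma deriv_geo: "fps_deriv (geo a) = - (fps_const a * geo a ^ 2)"
proof -
  let ?u = "1 + fps_const a * fps_X"
  have "0 = fps_deriv (?u * geo a)" by (simp only: geo_inverse fps_deriv_1)
  also have "\<dots> = ?u * fps_deriv (geo a) + fps_const a * geo a"
    by (simp add: algebra_simps)
  finally have *: "?u * fps_deriv (geo a) = - (fps_const a * geo a)"
    by (simp add: eq_neg_iff_add_eq_0)
  have "fps_deriv (geo a) = (?u * geo a) * fps_deriv (geo a)" by (simp add: geo_inverse)
  also have "\<dots> = geo a * (?u * fps_deriv (geo a))" by (simp only: mult_ac)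
  finally show ?thesis unfolding * by (simp add: power2_eq_square mult_ac)
qed

text \<open>The binomial series for (1 + a z)^(-m). Multiplication by 1 + a z lowers m by one, which
  on coefficients is Pascal's rule.\<close>

lemma nth_geo_power:
  "fps_nth (geo a ^ m) r = (- a) ^ r * of_nat ((m + r - 1) choose r)"
proof -
  define h where "h m = Abs_fps (\<lambda>r. (- a) ^ r * of_nat ((m + r - 1) choose r))" for m
  have rec: "(1 + fps_const a * fps_X) * h (Suc m) = h m" for m
  proof (rule fps_ext)
    fix n show "fps_nth ((1 + fps_const a * fps_X) * h (Suc m)) n = fps_nth (h m) n"
    proof (cases n)
      case (Suc k)
      have "(m + Suc k) choose Suc k = (m + k choose k) + (m + k choose Suc k)"
        by simp
      then show ?thesis
        by (simp add: Suc h_def distrib_right mult.assoc algebra_simps del: binomial_Suc_Suc)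
    qed (simp add: h_def distrib_right mult.assoc)
  qed
  have "geo a ^ m = h m"
  proof (induction m)
    \<comment> \<open>Truncated subtraction gives the right constant series here: 0 choose 0 is 1,
      and r - 1 choose r is 0 for r > 0.\<close>
    case 0
    show ?case
    proof (rule fps_ext)
      fix n show "fps_nth (geo a ^ 0) n = fps_nth (h 0) n"
        by (cases n) (simp_all add: h_def binomial_eq_0)
    qed
  next
    case (Suc m)
    have "geo a ^ Suc m = geo a * ((1 + fps_const a * fps_X) * h (Suc m))"
      by (simp add: rec Suc)
    also have "\<dots> = h (Suc m)"
      by (metis geo_inverse mult.assoc mult.commute mult.left_neutral)
    finally show ?case .
  qed
  then show ?thesis by (simp add: h_def)
qed

text \<open>
  \<open>walk_gf x N\<close> is $\sum_n \mathrm{tr}(M^n) z^n$ with $M_{ac} = [a \neq c]\, x_c$, and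
  \<open>alt_pow_gf x N\<close> is $P(z)$.
\<close>

definition walk_gf :: "(nat \<Rightarrow> 'a::comm_ring_1) \<Rightarrow> nat \<Rightarrow> 'a fps" where
  "walk_gf x N = Abs_fps (\<lambda>n. \<Sum>a<N. walk x N n a a)"

definition alt_pow_gf :: "(nat \<Rightarrow> 'a::comm_ring_1) \<Rightarrow> nat \<Rightarrow> 'a fps" where
  "alt_pow_gf x N = (\<Sum>a<N. fps_const (x a) * fps_X * geo (x a))"

lemma deriv_alt_pow_gf:
  "fps_deriv (alt_pow_gf x N) = (\<Sum>a<N. fps_const (x a) * geo (x a) ^ 2)"
  by (simp add: alt_pow_gf_def geo_eq deriv_geo fps_deriv_sum)

text \<open>The resolvent of a rank-one perturbation. With R the series of matrix powers and S_a the
  weighted row sum, each entry satisfies R_ab (1 + x_b z) = [a = b] + z S_a. Solving for R_ab and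
  summing over b leaves one scalar equation for S_a, and the trace follows. Denominators stay
  cleared.\<close>

lemma walk_gf_eq:
  "(1 - alt_pow_gf x N) * (walk_gf x N - (\<Sum>a<N. geo (x a))) = fps_X * fps_deriv (alt_pow_gf x N)"
proof -
  let ?c = "\<lambda>a. fps_const (x a)"
  let ?P = "alt_pow_gf x N"
  define R where "R a b = Abs_fps (\<lambda>n. walk x N n a b)" for a b
  define S where "S a = (\<Sum>b<N. R a b * ?c b)" for a
  let ?d = "\<lambda>a b. if a = b then 1 else 0 :: 'a fps"
  have R: "R a b * (1 + ?c b * fps_X) = ?d a b + fps_X * S a" if "b < N" for a b
  proof -
    \<comment> \<open>The last step of a walk sums over all c except b, hence the full row sum minus
      the diagonal term.\<close>
    have "R a b = ?d a b + fps_X * (S a - R a b * ?c b)"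
    proof (rule fps_ext)
      fix n
      show "fps_nth (R a b) n = fps_nth (?d a b + fps_X * (S a - R a b * ?c b)) n"
        using that by (cases n) (auto simp: R_def S_def fps_sum_nth sum_diff1)
    qed
    then show ?thesis by (simp add: algebra_simps)
  qed
  have Rg: "R a b = geo (x b) * (?d a b + fps_X * S a)" if "b < N" for a b
  proof -
    have "R a b = R a b * ((1 + ?c b * fps_X) * geo (x b))"
      by (simp add: geo_inverse)
    also have "\<dots> = R a b * (1 + ?c b * fps_X) * geo (x b)"
      by (simp only: mult.assoc)
    finally show ?thesis using R[OF that] by (simp add: mult.commute)
  qed
  have S: "(1 - ?P) * S a = ?c a * geo (x a)" if "a < N" for a
  proof -
    have "S a = (\<Sum>b<N. (if a = b then ?c b * geo (x b) else 0) + S a * (?c b * fps_X * geo (x b)))"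
      unfolding S_def[of a] by (intro sum.cong refl, subst Rg) (auto simp: algebra_simps S_def)
    also have "\<dots> = ?c a * geo (x a) + S a * ?P"
      using that by (simp add: sum.distrib sum_distrib_left alt_pow_gf_def)
    finally show ?thesis by (simp add: algebra_simps)
  qed
  have "walk_gf x N = (\<Sum>a<N. R a a)"
    by (rule fps_ext) (simp add: walk_gf_def R_def fps_sum_nth)
  also have "\<dots> = (\<Sum>a<N. geo (x a)) + (\<Sum>a<N. geo (x a) * fps_X * S a)"
    by (simp add: Rg distrib_left sum.distrib mult.assoc)
  finally have "(1 - ?P) * (walk_gf x N - (\<Sum>a<N. geo (x a))) =
      (\<Sum>a<N. geo (x a) * fps_X * ((1 - ?P) * S a))"
    by (simp add: sum_distrib_left mult_ac)
  also have "\<dots> = fps_X * fps_deriv ?P"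
    unfolding deriv_alt_pow_gf sum_distrib_left
    by (intro sum.cong refl, subst S) (auto simp: power2_eq_square mult_ac)
  finally show ?thesis .
qed

definition star_gf :: "(nat \<Rightarrow> 'a::comm_ring_1) \<Rightarrow> nat \<Rightarrow> nat \<Rightarrow> 'a fps" where
  "star_gf x N n = (\<Sum>j\<in>{2..n}. fps_const (\<Sum>a<N. x a * ((\<Sum>i<N. x i) - x a) ^ (j - 1))
     * (fps_X ^ j * geo (\<Sum>i<N. x i) ^ (j - 1)))"

text \<open>
  This holds because $P(z) = \sum_{j \ge 1} \mathfrak{st}_j w^j$ for $w = z / (1 + s z)$.
  Only the parts up to \<open>n\<close> are kept in \<open>star_gf\<close>, so the identity holds modulo $z^{n+1}$.
\<close>

lemma star_gf_eq:
  fixes x :: "nat \<Rightarrow> 'a::comm_ring_1" and N n :: nat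
  assumes "n \<ge> 1"
  defines "s \<equiv> \<Sum>i<N. x i"
  obtains E where "1 - star_gf x N n = (1 + fps_const s * fps_X) * (1 - alt_pow_gf x N) + fps_X ^ Suc n * E"
proof -
  let ?u = "1 + fps_const s * fps_X" and ?v = "geo s"
  define c where "c a = fps_const (x a)" for a
  define q where "q a = fps_const (s - x a) * fps_X * ?v" for a
  \<comment> \<open>1 - q = (1 + x_a z) / (1 + s z), so the factor on the right is the inverse of 1
    - q.\<close>
  have q1: "(1 - q a) * (?u * geo (x a)) = 1" for a
  proof -
    have "(1 - q a) * ?u = ?u - fps_const (s - x a) * fps_X * (?u * ?v)"
      unfolding q_def by (simp only: left_diff_distrib mult_1_left) (simp only: mult_ac)
    also have "\<dots> = 1 + fps_const (x a) * fps_X"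
      by (simp only: geo_inverse) (simp add: algebra_simps flip: fps_const_sub)
    finally show ?thesis by (simp only: mult.assoc[symmetric] geo_inverse)
  qed
  have geom: "(\<Sum>i<n. q a ^ i) = ?u * geo (x a) * (1 - q a ^ n)" for a
  proof -
    have "(1 - q a) * (\<Sum>i<n. q a ^ i) = 1 - q a ^ n"
      by (simp add: one_diff_power_eq)
    then have "?u * geo (x a) * (1 - q a ^ n) = ?u * geo (x a) * ((1 - q a) * (\<Sum>i<n. q a ^ i))"
      by (simp only:)
    also have "\<dots> = ((1 - q a) * (?u * geo (x a))) * (\<Sum>i<n. q a ^ i)"
      by (simp only: mult_ac)
    finally show ?thesis unfolding q1 by simp
  qed
  have "star_gf x N n = (\<Sum>j\<in>{2..n}. \<Sum>a<N. c a * fps_X * q a ^ (j - 1))"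
    unfolding star_gf_def
  proof (intro sum.cong refl)
    fix j assume "j \<in> {2..n}"
    then have X: "fps_X ^ j = fps_X * (fps_X :: 'a fps) ^ (j - 1)"
      by (cases j) auto
    show "fps_const (\<Sum>a<N. x a * ((\<Sum>i<N. x i) - x a) ^ (j - 1)) * (fps_X ^ j * geo (\<Sum>i<N. x i) ^ (j - 1)) =
        (\<Sum>a<N. c a * fps_X * q a ^ (j - 1))"
      unfolding X fps_const_sum sum_distrib_right q_def c_def s_def power_mult_distrib fps_const_power
      by (intro sum.cong refl) (simp add: mult_ac flip: fps_const_mult)
  qed
  also have "\<dots> = (\<Sum>i\<in>{1..<n}. \<Sum>a<N. c a * fps_X * q a ^ i)"
    by (rule sum.reindex_bij_witness[where i = Suc and j = "\<lambda>j. j - 1"]) auto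
  \<comment> \<open>The summand s z is the part j = 1, which B leaves out; it completes the
    geometric sum at exponent 0.\<close>
  also have "\<dots> + fps_const s * fps_X = (\<Sum>i<n. \<Sum>a<N. c a * fps_X * q a ^ i)"
  proof -
    have "{..<n} = insert 0 {1..<n}" using assms by auto
    then show ?thesis by (simp add: s_def c_def sum_distrib_right fps_const_sum)
  qed
  also have "\<dots> = (\<Sum>a<N. c a * fps_X * (\<Sum>i<n. q a ^ i))"
    by (subst sum.swap) (simp add: sum_distrib_left)
  also have "\<dots> = ?u * alt_pow_gf x N - fps_X ^ Suc n *
      (\<Sum>a<N. c a * (?u * geo (x a)) * (fps_const (s - x a) * ?v) ^ n)"
    unfolding geom
    by (simp add: q_def alt_pow_gf_def c_def power_mult_distrib algebra_simps sum_distrib_left sum_subtractf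
        flip: fps_const_mult)
  finally have "star_gf x N n + fps_const s * fps_X = \<dots>" .
  then have "1 - star_gf x N n = ?u * (1 - alt_pow_gf x N) + fps_X ^ Suc n *
      (\<Sum>a<N. c a * (?u * geo (x a)) * (fps_const (s - x a) * ?v) ^ n)"
    by (simp add: algebra_simps)
  then show thesis by (rule that)
qed

text \<open>Logarithmic differentiation of 1 - P = (1 - B) / (1 + s z). All errors are carried as
  explicit multiples of Z = z^(n+1), and division by 1 - B is replaced by the finite geometric sum
  of powers of B.\<close>

lemma nth_walk_gf_star:
  fixes x :: "nat \<Rightarrow> 'a::comm_ring_1" and N n :: nat
  assumes "n \<ge> 1"
  defines "s \<equiv> \<Sum>i<N. x i" and "B \<equiv> star_gf x N n"
  shows "fps_nth (walk_gf x N) n =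
    (\<Sum>a<N. (- x a) ^ n) - (- s) ^ n + (\<Sum>k\<le>n. fps_nth (fps_X * fps_deriv B * B ^ k) n)"
proof -
  define u where "u = 1 + fps_const s * fps_X"
  define v where "v = geo s"
  define P where "P = alt_pow_gf x N"
  define L where "L = walk_gf x N - (\<Sum>a<N. geo (x a))"
  define Z where "Z = (fps_X :: 'a fps) ^ Suc n"
  have uv: "u * v = 1" by (simp add: u_def v_def geo_inverse)
  obtain E where E: "1 - B = u * (1 - P) + Z * E"
    using star_gf_eq[OF assms(1), of x N] unfolding B_def u_def P_def s_def Z_def by blast
  have PL: "(1 - P) * L = fps_X * fps_deriv P"
    unfolding P_def L_def by (rule walk_gf_eq)
  \<comment> \<open>z d/dz maps multiples of Z to multiples of Z, whereas the plain derivative would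
    lose one order.\<close>
  have dZ: "fps_X * fps_deriv Z = of_nat (Suc n) * Z"
  proof (rule fps_ext)
    fix m show "fps_nth (fps_X * fps_deriv Z) m = fps_nth (of_nat (Suc n) * Z) m"
      by (cases m) (auto simp: Z_def simp del: power_Suc of_nat_Suc)
  qed
  have "1 - P = v * (1 - B) - Z * (v * E)"
  proof -
    have "v * (1 - B) = (u * v) * (1 - P) + Z * (v * E)"
      unfolding E by (simp add: algebra_simps)
    then show ?thesis by (simp add: uv)
  qed
  then obtain F where F: "P = 1 - v * (1 - B) + Z * F"
    by (metis (no_types, opaque_lifting) add_diff_cancel_left' diff_add_eq diff_diff_eq2)
  have dP: "fps_X * fps_deriv P = fps_X * (v * fps_deriv B) - fps_X * fps_deriv v * (1 - B)
      + Z * (of_nat (Suc n) * F + fps_X * fps_deriv F)"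
  proof -
    have "fps_X * fps_deriv P = fps_X * (v * fps_deriv B) - fps_X * fps_deriv v * (1 - B)
      + (fps_X * fps_deriv Z) * F + Z * (fps_X * fps_deriv F)"
      unfolding F by (simp add: algebra_simps)
    then show ?thesis unfolding dZ by (simp add: algebra_simps del: of_nat_Suc)
  qed
  have udv: "u * fps_deriv v = - (fps_const s * v)"
  proof -
    have "u * fps_deriv v = - (fps_const s * ((u * v) * v))"
      unfolding v_def deriv_geo by (simp add: power2_eq_square mult_ac)
    then show ?thesis by (simp add: uv)
  qed
  \<comment> \<open>From 1 - P = v (1 - B) comes z P' / (1 - P) = - z v' / v + z B' / (1 - B), with
    - z v' / v = s z v.\<close>
  obtain H where H: "(1 - B) * (L - fps_const s * fps_X * v) = fps_X * fps_deriv B + Z * H"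
  proof -
    have "(1 - B) * L = (u * v) * (1 - B) * L"
      by (simp add: uv)
    also have "\<dots> = u * ((1 - P) * L + Z * F * L)"
      unfolding F by (simp add: algebra_simps)
    also have "\<dots> = (u * v) * fps_X * fps_deriv B - fps_X * (u * fps_deriv v) * (1 - B)
       + Z * (u * (of_nat (Suc n) * F + fps_X * fps_deriv F + F * L))"
      unfolding PL dP by (simp add: algebra_simps del: of_nat_Suc)
    finally have "(1 - B) * (L - fps_const s * fps_X * v) = fps_X * fps_deriv B
       + Z * (u * (of_nat (Suc n) * F + fps_X * fps_deriv F + F * L))"
      unfolding uv udv by (simp add: algebra_simps del: of_nat_Suc)
    then show thesis by (rule that)
  qed
  \<comment> \<open>B has no constant term, so B^(n+1) is a multiple of Z and the geometric sum may
    stop at n.\<close>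
  obtain C where C: "B = fps_X * C"
  proof -
    have "fps_X dvd B"
      unfolding B_def star_gf_def by (intro dvd_sum dvd_mult dvd_mult2) (auto intro!: dvd_power)
    then show thesis using that by (auto elim: dvdE)
  qed
  have BZ: "B ^ Suc n = Z * C ^ Suc n"
    unfolding C Z_def by (rule power_mult_distrib)
  let ?W = "\<Sum>k\<le>n. B ^ k"
  have geo: "(1 - B) * ?W = 1 - Z * C ^ Suc n"
    using one_diff_power_eq[of B "Suc n"] unfolding BZ lessThan_Suc_atMost by simp
  let ?D = "L - fps_const s * fps_X * v"
  have "?D - Z * C ^ Suc n * ?D = ((1 - B) * ?W) * ?D"
    unfolding geo by (simp add: algebra_simps)
  also have "\<dots> = ((1 - B) * ?D) * ?W" by (simp only: mult_ac)
  also have "\<dots> = fps_X * fps_deriv B * ?W + Z * (H * ?W)"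
    unfolding H by (simp add: algebra_simps)
  finally have LE: "L = fps_const s * fps_X * v + fps_X * fps_deriv B * ?W + Z * (H * ?W + C ^ Suc n * ?D)"
    by (simp add: algebra_simps del: power_Suc)
  have "fps_nth (Z * f) n = 0" for f
    unfolding Z_def by (simp only: fps_X_power_mult_nth) simp
  with arg_cong[OF LE, of "\<lambda>f. fps_nth f n"] have "fps_nth L n = fps_nth (fps_const s * fps_X * v) n + fps_nth (fps_X * fps_deriv B * ?W) n"
    by (simp only: fps_add_nth add_0_right)
  also have "fps_nth (fps_const s * fps_X * v) n = - ((- s) ^ n)"
    unfolding v_def geo_eq using assms(1) by simp
  finally show ?thesis
    by (simp add: L_def fps_sum_nth sum_distrib_left algebra_simps)
qed

text \<open>Compare z (B^(k+1))' computed by the chain rule and coefficientwise. This is the source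
  of the factor n / (k + 1); the division waits until rational scalars are available.\<close>

lemma nth_X_deriv_power:
  fixes B :: "'a::comm_ring_1 fps"
  shows "of_nat (Suc k) * fps_nth (fps_X * fps_deriv B * B ^ k) n = of_nat n * fps_nth (B ^ Suc k) n"
proof -
  have "fps_nth (fps_X * fps_deriv (B ^ Suc k)) n = of_nat n * fps_nth (B ^ Suc k) n"
    by (cases n) (simp_all del: power_Suc)
  moreover have "fps_X * fps_deriv (B ^ Suc k) = fps_const (of_nat (Suc k)) * (fps_X * fps_deriv B * B ^ k)"
    by (simp only: fps_deriv_power' diff_Suc_1) (simp add: fps_of_nat mult_ac del: of_nat_Suc)
  ultimately show ?thesis by (metis fps_mult_left_const_nth)
qed

lemma power_sum_lists:
  fixes f :: "'b \<Rightarrow> 'a::comm_ring_1"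
  assumes "finite A"
  shows "(\<Sum>j\<in>A. f j) ^ K = (\<Sum>xs\<in>{xs. set xs \<subseteq> A \<and> length xs = K}. \<Prod>j\<leftarrow>xs. f j)"
proof (induction K)
  case 0
  have "{xs. set xs \<subseteq> A \<and> length xs = 0} = {[]}" by auto
  then show ?case by simp
next
  case (Suc K)
  let ?L = "\<lambda>K. {xs. set xs \<subseteq> A \<and> length xs = K}"
  have "(\<Sum>j\<in>A. f j) ^ Suc K = (\<Sum>(j, xs)\<in>A \<times> ?L K. f j * (\<Prod>j\<leftarrow>xs. f j))"
    by (simp add: Suc sum_product sum.cartesian_product)
  also have "\<dots> = (\<Sum>xs\<in>?L (Suc K). \<Prod>j\<leftarrow>xs. f j)"
    by (rule sum.reindex_bij_witness[where i = "\<lambda>xs. (hd xs, tl xs)" and j = "\<lambda>(j, xs). j # xs"])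
      (auto simp: length_Suc_conv)
  finally show ?case .
qed

text \<open>Group the words of the expanded product by their multiset of letters. Counting
  arrangements instead of dividing factorials keeps the statement valid in any commutative
  ring.\<close>

lemma multinomial_theorem:
  fixes f :: "'b \<Rightarrow> 'a::comm_ring_1"
  assumes "finite A"
  shows "(\<Sum>j\<in>A. f j) ^ K =
    (\<Sum>\<nu>\<in>multisets_of_size A K. of_nat (card (permutations_of_multiset \<nu>)) * (\<Prod>j\<in>#\<nu>. f j))"
proof -
  let ?L = "{xs. set xs \<subseteq> A \<and> length xs = K}"
  have "(\<Sum>j\<in>A. f j) ^ K = (\<Sum>xs\<in>?L. \<Prod>j\<in>#mset xs. f j)"
    using power_sum_lists[OF assms, of f K] by (simp flip: prod_mset_prod_list)
  also have "\<dots> = (\<Sum>\<nu>\<in>multisets_of_size A K. \<Sum>xs\<in>{xs \<in> ?L. mset xs = \<nu>}. \<Prod>j\<in>#mset xs. f j)"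
  proof (rule sum.group[symmetric])
    show "finite (multisets_of_size A K)" using assms by auto
  qed (use assms in \<open>auto simp: finite_lists_length_eq multisets_of_size_def\<close>)
  also have "\<dots> = (\<Sum>\<nu>\<in>multisets_of_size A K. \<Sum>xs\<in>permutations_of_multiset \<nu>. \<Prod>j\<in>#\<nu>. f j)"
  proof (rule sum.cong[OF refl])
    fix \<nu> assume "\<nu> \<in> multisets_of_size A K"
    then have "{xs \<in> ?L. mset xs = \<nu>} = permutations_of_multiset \<nu>"
      by (auto simp: permutations_of_multiset_def multisets_of_size_def)
    then show "(\<Sum>xs\<in>{xs \<in> ?L. mset xs = \<nu>}. \<Prod>j\<in>#mset xs. f j) =
        (\<Sum>xs\<in>permutations_of_multiset \<nu>. \<Prod>j\<in>#\<nu>. f j)"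
      by (auto simp: permutations_of_multiset_def intro!: sum.cong)
  qed
  finally show ?thesis by simp
qed

text \<open>The parts in \<nu> multiply to z^t (1 + s z)^(K - t) with t the sum of \<nu>, and
  \<open>nth_geo_power\<close> reads off the rest. The upper index (t - K) + (n - t) - 1 depends on
  \<nu> only through its length.\<close>

lemma nth_star_gf_power:
  fixes x :: "nat \<Rightarrow> 'a::comm_ring_1" and N n :: nat
  assumes "K \<ge> 1"
  defines "s \<equiv> \<Sum>i<N. x i"
  shows "fps_nth (star_gf x N n ^ K) n =
    (\<Sum>\<nu>\<in>{\<nu> \<in> multisets_of_size {2..n} K. sum_mset \<nu> \<le> n}.
      of_nat (card (permutations_of_multiset \<nu>)) * (\<Prod>j\<in>#\<nu>. \<Sum>a<N. x a * (s - x a) ^ (j - 1)) *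
      ((- s) ^ (n - sum_mset \<nu>) * of_nat ((n - K - 1) choose (n - sum_mset \<nu>))))"
proof -
  let ?st = "\<lambda>j. \<Sum>a<N. x a * (s - x a) ^ (j - 1)"
  let ?f = "\<lambda>j. fps_const (?st j) * (fps_X ^ j * geo s ^ (j - 1))"
  have prod: "(\<Prod>j\<in>#\<nu>. ?f j) = fps_const (\<Prod>j\<in>#\<nu>. ?st j) * (fps_X ^ sum_mset \<nu> * geo s ^ (sum_mset \<nu> - size \<nu>))
      \<and> size \<nu> \<le> sum_mset \<nu>"
    if "set_mset \<nu> \<subseteq> {2..n}" for \<nu>
    using that
  proof (induction \<nu>)
    case (add j \<nu>)
    then have "j + sum_mset \<nu> - Suc (size \<nu>) = (j - 1) + (sum_mset \<nu> - size \<nu>)"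
      by auto
    then have "geo s ^ (j + sum_mset \<nu> - Suc (size \<nu>)) = geo s ^ (j - 1) * geo s ^ (sum_mset \<nu> - size \<nu>)"
      by (simp only: power_add)
    with add show ?case
      by (auto simp: power_add mult_ac simp flip: fps_const_mult)
  qed simp
  have size: "size \<nu> < sum_mset \<nu>" if "set_mset \<nu> \<subseteq> {2..n}" "size \<nu> = K" for \<nu>
  proof -
    have "2 * size \<nu> \<le> sum_mset \<nu>" using that(1) by (induction \<nu>) auto
    then show ?thesis using that(2) assms(1) by linarith
  qed
  have "fps_nth (star_gf x N n ^ K) n = (\<Sum>\<nu>\<in>multisets_of_size {2..n} K.
      of_nat (card (permutations_of_multiset \<nu>)) * fps_nth (\<Prod>j\<in>#\<nu>. ?f j) n)"
    unfolding star_gf_def s_def[symmetric] multinomial_theorem[OF finite_atLeastAtMost]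
    by (simp add: fps_sum_nth flip: fps_of_nat)
  also have "\<dots> = (\<Sum>\<nu>\<in>{\<nu> \<in> multisets_of_size {2..n} K. sum_mset \<nu> \<le> n}.
      of_nat (card (permutations_of_multiset \<nu>)) * fps_nth (\<Prod>j\<in>#\<nu>. ?f j) n)"
  proof (rule sum.mono_neutral_right)
    show "finite (multisets_of_size {2..n} K)" by auto
    show "\<forall>\<nu>\<in>multisets_of_size {2..n} K - {\<nu> \<in> multisets_of_size {2..n} K. sum_mset \<nu> \<le> n}.
        of_nat (card (permutations_of_multiset \<nu>)) * fps_nth (\<Prod>j\<in>#\<nu>. ?f j) n = 0"
      using prod by (auto simp: multisets_of_size_def fps_X_power_mult_nth)
  qed auto
  also have "\<dots> = (\<Sum>\<nu>\<in>{\<nu> \<in> multisets_of_size {2..n} K. sum_mset \<nu> \<le> n}.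
      of_nat (card (permutations_of_multiset \<nu>)) * (\<Prod>j\<in>#\<nu>. ?st j) *
      ((- s) ^ (n - sum_mset \<nu>) * of_nat ((n - K - 1) choose (n - sum_mset \<nu>))))"
  proof (rule sum.cong[OF refl])
    fix \<nu> assume "\<nu> \<in> {\<nu> \<in> multisets_of_size {2..n} K. sum_mset \<nu> \<le> n}"
    then have \<nu>: "set_mset \<nu> \<subseteq> {2..n}" "size \<nu> = K" "sum_mset \<nu> \<le> n"
      by (auto simp: multisets_of_size_def)
    have e: "sum_mset \<nu> - size \<nu> + (n - sum_mset \<nu>) - 1 = n - K - 1"
      using size[OF \<nu>(1,2)] \<nu> by linarith
    have "fps_nth (\<Prod>j\<in>#\<nu>. ?f j) n = (\<Prod>j\<in>#\<nu>. ?st j) *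
        fps_nth (geo s ^ (sum_mset \<nu> - size \<nu>)) (n - sum_mset \<nu>)"
      using prod[OF \<nu>(1)] \<nu>(3) by (simp add: fps_X_power_mult_nth)
    then show "of_nat (card (permutations_of_multiset \<nu>)) * fps_nth (\<Prod>j\<in>#\<nu>. ?f j) n =
      of_nat (card (permutations_of_multiset \<nu>)) * (\<Prod>j\<in>#\<nu>. ?st j) *
      ((- s) ^ (n - sum_mset \<nu>) * of_nat ((n - K - 1) choose (n - sum_mset \<nu>)))"
      unfolding nth_geo_power e by (simp add: mult.assoc)
  qed
  finally show ?thesis .
qed


section \<open>The star-expansion of the cycle\<close>

lemma trunc_star_sf_1: "trunc N (star_sf 1) = (\<Sum>i<N. var i)"
  using trunc_star[of N 0] by simp

lemma trunc_star_sf_partition: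
  assumes "0 \<notin># \<nu>"
  shows "trunc N (star_sf_partition \<nu>) =
    (\<Prod>j\<in>#\<nu>. \<Sum>a<N. var a * ((\<Sum>i<N. var i) - var a) ^ (j - 1))"
proof -
  have "trunc N (star_sf j) = (\<Sum>a<N. var a * ((\<Sum>i<N. var i) - var a) ^ (j - 1))" if "j \<in># \<nu>" for j
    using that assms trunc_star[of N "j - 1"] by (cases j) auto
  then show ?thesis
    unfolding star_sf_partition_def trunc_prod_mset by (simp cong: image_mset_cong)
qed

text \<open>\<open>\<nu>\<close> collects the parts of a partition of \<open>n\<close> other than 1; \<open>pad n \<nu>\<close> restores the parts 1.\<close>

definition big_parts :: "nat \<Rightarrow> nat multiset set" where
  "big_parts n = {\<nu>. set_mset \<nu> \<subseteq> {2..} \<and> \<nu> \<noteq> {#} \<and> sum_mset \<nu> \<le> n}"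

definition pad :: "nat \<Rightarrow> nat multiset \<Rightarrow> nat multiset" where
  "pad n \<nu> = \<nu> + replicate_mset (n - sum_mset \<nu>) 1"

lemma star_sf_partition_pad:
  "star_sf_partition (pad n \<nu>) = star_sf_partition \<nu> * star_sf 1 ^ (n - sum_mset \<nu>)"
  by (simp add: pad_def star_sf_partition_def)

lemma big_parts_le: "\<nu> \<in> big_parts n \<Longrightarrow> set_mset \<nu> \<subseteq> {2..n}"
  by (force simp: big_parts_def dest!: multi_member_split)

text \<open>The contribution of \<nu> to n/k times [z^n] B^k for k = \<open>size \<nu>\<close>, with
  the sign of (-s)^r moved into the coefficient.\<close>

definition multi_coeff :: "nat \<Rightarrow> nat multiset \<Rightarrow> rat" where
  "multi_coeff n \<nu> = of_nat n / of_nat (size \<nu>) * of_nat (card (permutations_of_multiset \<nu>)) *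
    ((-1) ^ (n - sum_mset \<nu>) * of_nat ((n - size \<nu> - 1) choose (n - sum_mset \<nu>)))"

lemma finite_big_parts: "finite (big_parts n)"
proof (rule finite_subset)
  show "big_parts n \<subseteq> (\<Union>k\<le>n. multisets_of_size {2..n} k)"
  proof
    fix \<nu> assume \<nu>: "\<nu> \<in> big_parts n"
    have "size \<nu> \<le> sum_mset \<nu>" if "set_mset \<nu> \<subseteq> {2..n}"
      using that by (induction \<nu>) auto
    with \<nu> big_parts_le[OF \<nu>] show "\<nu> \<in> (\<Union>k\<le>n. multisets_of_size {2..n} k)"
      by (auto simp: multisets_of_size_def big_parts_def)
  qed
qed auto

text \<open>Sorting by length, shifted by one to match the powers B^(k+1). A multiset of sum at most
  n with positive parts has length at most n.\<close>

lemma big_parts_Union: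
  "big_parts n = (\<Union>k\<le>n. {\<nu> \<in> multisets_of_size {2..n} (Suc k). sum_mset \<nu> \<le> n})"
proof (intro equalityI subsetI)
  fix \<nu> assume \<nu>: "\<nu> \<in> big_parts n"
  have "size \<nu> \<le> sum_mset \<nu>" if "set_mset \<nu> \<subseteq> {2..n}"
    using that by (induction \<nu>) auto
  then have "size \<nu> \<le> n" using big_parts_le[OF \<nu>] \<nu> by (auto simp: big_parts_def)
  moreover have "size \<nu> > 0"
    using \<nu> unfolding big_parts_def nonempty_has_size by blast
  ultimately have "size \<nu> - 1 \<le> n" "size \<nu> = Suc (size \<nu> - 1)" by auto
  then show "\<nu> \<in> (\<Union>k\<le>n. {\<nu> \<in> multisets_of_size {2..n} (Suc k). sum_mset \<nu> \<le> n})"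
    using big_parts_le[OF \<nu>] \<nu> unfolding multisets_of_size_def big_parts_def by blast
next
  fix \<nu> assume "\<nu> \<in> (\<Union>k\<le>n. {\<nu> \<in> multisets_of_size {2..n} (Suc k). sum_mset \<nu> \<le> n})"
  then show "\<nu> \<in> big_parts n"
    by (auto simp: multisets_of_size_def big_parts_def)
qed

lemma chromatic_cycle_eq:
  assumes "n \<ge> 2"
  shows "chromatic_sf (cycle_graph n) = scalar ((-1) ^ n) * (pow_sf n - star_sf 1 ^ n) +
    (\<Sum>\<nu>\<in>big_parts n. scalar (multi_coeff n \<nu>) * star_sf_partition (pad n \<nu>))"
proof (rule mseries_eq_trunc)
  fix N
  let ?s = "\<Sum>i<N. var i"
  let ?B = "star_gf var N n"
  let ?V = "\<lambda>k. {\<nu> \<in> multisets_of_size {2..n} (Suc k). sum_mset \<nu> \<le> n}"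
  have coeff: "fps_nth (fps_X * fps_deriv ?B * ?B ^ k) n =
      (\<Sum>\<nu>\<in>?V k. scalar (multi_coeff n \<nu>) * trunc N (star_sf_partition (pad n \<nu>)))" for k
  proof -
    \<comment> \<open>\<open>nth_X_deriv_power\<close> is divided by k + 1, which is possible
      because \<open>scalar\<close> embeds the rationals.\<close>
    have "fps_nth (fps_X * fps_deriv ?B * ?B ^ k) n =
        scalar (1 / of_nat (Suc k)) * (of_nat (Suc k) * fps_nth (fps_X * fps_deriv ?B * ?B ^ k) n)"
      by (simp del: of_nat_Suc flip: scalar_of_nat scalar_mult mult.assoc)
    also have "\<dots> = scalar (of_nat n / of_nat (Suc k)) * fps_nth (?B ^ Suc k) n"
      unfolding nth_X_deriv_power
      by (simp del: of_nat_Suc power_Suc flip: scalar_of_nat scalar_mult mult.assoc)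
    also have "\<dots> = (\<Sum>\<nu>\<in>?V k. scalar (multi_coeff n \<nu>) * trunc N (star_sf_partition (pad n \<nu>)))"
      unfolding nth_star_gf_power[of "Suc k", OF le_add1[of 1 k, unfolded plus_1_eq_Suc]] sum_distrib_left
    proof (rule sum.cong[OF refl])
      fix \<nu> assume "\<nu> \<in> ?V k"
      then have \<nu>: "size \<nu> = Suc k" "0 \<notin># \<nu>" by (auto simp: multisets_of_size_def)
      have "(- ?s) ^ r = scalar ((-1) ^ r) * ?s ^ r" for r
        by (subst power_minus) (simp add: scalar_power scalar_minus)
      then show "scalar (of_nat n / of_nat (Suc k)) *
          (of_nat (card (permutations_of_multiset \<nu>)) *
            (\<Prod>j\<in>#\<nu>. \<Sum>a<N. var a * (?s - var a) ^ (j - 1)) *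
            ((- ?s) ^ (n - sum_mset \<nu>) * of_nat (n - Suc k - 1 choose (n - sum_mset \<nu>)))) =
          scalar (multi_coeff n \<nu>) * trunc N (star_sf_partition (pad n \<nu>))"
        unfolding star_sf_partition_pad trunc_mult trunc_power trunc_star_sf_1
          trunc_star_sf_partition[OF \<nu>(2)] multi_coeff_def \<nu>(1)
          scalar_mult scalar_of_nat
        by (simp add: mult_ac del: of_nat_Suc)
    qed
    finally show ?thesis .
  qed
  have fin: "finite (?V k)" for k
    by (rule finite_subset[of _ "multisets_of_size {2..n} (Suc k)"]) auto
  have disj: "?V i \<inter> ?V j = {}" if "i \<noteq> j" for i j
    using that by (auto simp: multisets_of_size_def)
  have "trunc N (chromatic_sf (cycle_graph n)) = fps_nth (walk_gf var N) n"
    using assms by (simp add: trunc_cycle walk_gf_def)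
  also have "\<dots> = (\<Sum>a<N. (- var a) ^ n) - (- ?s) ^ n + (\<Sum>k\<le>n. fps_nth (fps_X * fps_deriv ?B * ?B ^ k) n)"
    using assms by (intro nth_walk_gf_star) simp
  also have "(\<Sum>k\<le>n. fps_nth (fps_X * fps_deriv ?B * ?B ^ k) n) =
      (\<Sum>\<nu>\<in>big_parts n. scalar (multi_coeff n \<nu>) * trunc N (star_sf_partition (pad n \<nu>)))"
    unfolding coeff big_parts_Union
    by (rule sum.UNION_disjoint[symmetric]) (use fin disj in blast)+
  also have "(\<Sum>a<N. (- var a) ^ n) - (- ?s) ^ n = trunc N (scalar ((-1) ^ n) * (pow_sf n - star_sf 1 ^ n))"
  proof -
    have "(- y) ^ n = scalar ((-1) ^ n) * y ^ n" for y
      by (subst power_minus) (simp add: scalar_power scalar_minus)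
    moreover have "trunc N (f - g) = trunc N f - trunc N g" for f g
      using trunc_add[of N "f - g" g] by simp
    ultimately show ?thesis
      using assms trunc_star_sf_1[of N]
      by (simp add: trunc_mult trunc_scalar trunc_pow trunc_power sum_distrib_left right_diff_distrib)
  qed
  finally show "trunc N (chromatic_sf (cycle_graph n)) =
    trunc N (scalar ((-1) ^ n) * (pow_sf n - star_sf 1 ^ n) +
      (\<Sum>\<nu>\<in>big_parts n. scalar (multi_coeff n \<nu>) * star_sf_partition (pad n \<nu>)))"
    by (simp add: trunc_add trunc_sum trunc_mult[of _ "scalar _"] trunc_scalar)
qed

text \<open>In \<open>pow_sf_eq_star\<close> the summand r = 0 is the power of
  \<open>star_sf 1\<close> that is subtracted. Each remaining summand has the single big part r + 1,
  so only hooks receive a correction.\<close>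

lemma pow_sf_minus_star:
  assumes "n \<ge> 1"
  shows "scalar ((-1) ^ n) * (pow_sf n - star_sf 1 ^ n) = (\<Sum>\<nu>\<in>big_parts n.
    scalar (if size \<nu> = 1 then - ((-1) ^ (n - sum_mset \<nu>) * of_nat ((n - 1) choose (n - sum_mset \<nu>))) else 0)
      * star_sf_partition (pad n \<nu>))"
proof -
  obtain m where n: "n = Suc m" using assms by (cases n) auto
  let ?h = "\<lambda>\<nu>. - ((-1) ^ (n - sum_mset \<nu>) * of_nat ((n - 1) choose (n - sum_mset \<nu>))) :: rat"
  let ?t = "\<lambda>r. scalar ((-1) ^ r * of_nat (m choose r)) * (star_sf (Suc r) * star_sf 1 ^ (m - r))"
  have "{..m} = insert 0 {1..m}" by auto
  then have "pow_sf n - star_sf 1 ^ n = (\<Sum>r\<in>{1..m}. ?t r)"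
    unfolding n pow_sf_eq_star by simp
  then have "scalar ((-1) ^ n) * (pow_sf n - star_sf 1 ^ n) = (\<Sum>r\<in>{1..m}. scalar ((-1) ^ n) * ?t r)"
    by (simp add: sum_distrib_left)
  also have "\<dots> = (\<Sum>\<nu>\<in>{\<nu> \<in> big_parts n. size \<nu> = 1}. scalar (?h \<nu>) * star_sf_partition (pad n \<nu>))"
  proof (rule sum.reindex_bij_witness[where i = "\<lambda>\<nu>. sum_mset \<nu> - 1" and j = "\<lambda>r. {#Suc r#}"])
    fix \<nu> assume "\<nu> \<in> {\<nu> \<in> big_parts n. size \<nu> = 1}"
    then obtain j where "\<nu> = {#j#}" "2 \<le> j" "j \<le> n"
      by (auto simp: big_parts_def size_1_singleton_mset)
         (metis One_nat_def atLeast_iff in_mono set_mset_single singletonI size_1_singleton_mset sum_mset.singleton)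
    then show "{#Suc (sum_mset \<nu> - 1)#} = \<nu>" "sum_mset \<nu> - 1 \<in> {1..m}"
      by (auto simp: n)
  next
    fix r assume r: "r \<in> {1..m}"
    then show "{#Suc r#} \<in> {\<nu> \<in> big_parts n. size \<nu> = 1}" "sum_mset {#Suc r#} - 1 = r"
      by (auto simp: big_parts_def n)
    \<comment> \<open>m - r = n - (r + 1) is the number of parts 1, and n + r has the opposite
      parity.\<close>
    have "(-1 :: rat) ^ n * (-1) ^ r = - ((-1) ^ (m - r))"
    proof -
      have e: "n + r = Suc (2 * r + (m - r))" using r n by auto
      have "(-1 :: rat) ^ (n + r) = (-1) ^ Suc (2 * r + (m - r))" by (simp only: e)
      also have "\<dots> = - ((-1) ^ (m - r))"
        by (simp only: power_Suc power_add power_mult) simp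
      finally show ?thesis by (simp only: power_add)
    qed
    moreover have "m choose r = m choose (m - r)" using r by (intro binomial_symmetric) simp
    ultimately have "(-1) ^ n * ((-1) ^ r * of_nat (m choose r)) = ?h {#Suc r#}"
      by (simp add: n flip: mult.assoc)
    then show "scalar (?h {#Suc r#}) * star_sf_partition (pad n {#Suc r#}) = scalar ((-1) ^ n) * ?t r"
      by (simp only: mult.assoc[symmetric] scalar_mult[symmetric] star_sf_partition_pad)
         (simp add: star_sf_partition_def n mult.assoc)
  qed
  also have "\<dots> = (\<Sum>\<nu>\<in>big_parts n.
    scalar (if size \<nu> = 1 then ?h \<nu> else 0) * star_sf_partition (pad n \<nu>))"
    by (rule sum.mono_neutral_cong_left) (auto simp: finite_big_parts)
  finally show ?thesis .
qed

lemma filter_pad: "\<nu> \<in> big_parts n \<Longrightarrow> filter_mset (\<lambda>i. i \<noteq> 1) (pad n \<nu>) = \<nu>"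
  by (rule multiset_eqI) (auto simp: big_parts_def pad_def not_in_iff[symmetric])

text \<open>Removing the parts 1 is the inverse; it leaves nothing only for the partition into
  ones.\<close>

lemma bij_betw_pad:
  "bij_betw (pad n) (big_parts n) (partitions n - {replicate_mset n 1})"
proof (rule bij_betw_byWitness[where f' = "filter_mset (\<lambda>i. i \<noteq> 1)"])
  show "\<forall>\<nu>\<in>big_parts n. filter_mset (\<lambda>i. i \<noteq> 1) (pad n \<nu>) = \<nu>"
    using filter_pad by blast
  have split: "\<mu> = filter_mset (\<lambda>i. i \<noteq> 1) \<mu> + replicate_mset (count \<mu> 1) 1" for \<mu> :: "nat multiset"
    by (rule multiset_eqI) auto
  have sum: "sum_mset (filter_mset (\<lambda>i. i \<noteq> 1) \<mu>) + count \<mu> 1 = sum_mset \<mu>" for \<mu> :: "nat multiset"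
    by (subst (3) split[of \<mu>]) (simp add: sum_mset_replicate_mset)
  show "\<forall>\<mu>\<in>partitions n - {replicate_mset n 1}. pad n (filter_mset (\<lambda>i. i \<noteq> 1) \<mu>) = \<mu>"
  proof
    fix \<mu> assume "\<mu> \<in> partitions n - {replicate_mset n 1}"
    then have "n - sum_mset (filter_mset (\<lambda>i. i \<noteq> 1) \<mu>) = count \<mu> 1"
      using sum[of \<mu>] by (auto simp: partitions_def)
    then show "pad n (filter_mset (\<lambda>i. i \<noteq> 1) \<mu>) = \<mu>"
      using split[of \<mu>] by (simp add: pad_def)
  qed
  show "pad n ` big_parts n \<subseteq> partitions n - {replicate_mset n 1}"
  proof
    fix \<mu> assume "\<mu> \<in> pad n ` big_parts n"
    then obtain \<nu> where \<nu>: "\<nu> \<in> big_parts n" "\<mu> = pad n \<nu>" by auto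
    have "filter_mset (\<lambda>i. i \<noteq> 1) (replicate_mset n (1::nat)) = {#}"
      by (induction n) auto
    then have "\<mu> \<noteq> replicate_mset n 1"
      using filter_pad[OF \<nu>(1)] \<nu> by (auto simp: big_parts_def)
    moreover have "\<mu> \<in> partitions n"
      using \<nu> by (auto simp: big_parts_def pad_def partitions_def sum_mset_replicate_mset)
    ultimately show "\<mu> \<in> partitions n - {replicate_mset n 1}" by simp
  qed
  show "filter_mset (\<lambda>i. i \<noteq> 1) ` (partitions n - {replicate_mset n 1}) \<subseteq> big_parts n"
  proof
    fix \<nu> assume "\<nu> \<in> filter_mset (\<lambda>i. i \<noteq> 1) ` (partitions n - {replicate_mset n 1})"
    then obtain \<mu> where \<mu>: "\<mu> \<in> partitions n" "\<mu> \<noteq> replicate_mset n 1" "\<nu> = filter_mset (\<lambda>i. i \<noteq> 1) \<mu>"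
      by auto
    have "\<nu> \<noteq> {#}"
    proof
      assume "\<nu> = {#}"
      with \<mu>(3) have empty: "filter_mset (\<lambda>i. i \<noteq> 1) \<mu> = {#}" by simp
      have "\<mu> = replicate_mset (count \<mu> 1) 1"
        by (rule trans[OF split]) (simp only: empty add_0)
      moreover have "count \<mu> 1 = n"
        using sum[of \<mu>] \<mu>(1) unfolding empty by (simp add: partitions_def)
      ultimately have "\<mu> = replicate_mset n 1" by metis
      with \<mu> show False by simp
    qed
    moreover have "2 \<le> i" if "i \<in># \<nu>" for i
    proof -
      have "0 \<notin># \<mu>" using \<mu>(1) by (simp add: partitions_def)
      moreover have "i \<in># \<mu>" "i \<noteq> 1" using that \<mu>(3) by auto
      ultimately have "i \<noteq> 0" "i \<noteq> 1" by metis+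
      then show ?thesis by simp
    qed
    ultimately show "\<nu> \<in> big_parts n"
      using sum[of \<mu>] \<mu> by (auto simp: big_parts_def partitions_def)
  qed
qed

section \<open>The coefficients and their closed forms\<close>

definition cycle_coeff :: "nat \<Rightarrow> nat multiset \<Rightarrow> rat" where
  "cycle_coeff n \<mu> = (if \<mu> = replicate_mset n 1 then 0 else
    (let \<nu> = filter_mset (\<lambda>i. i \<noteq> 1) \<mu> in multi_coeff n \<nu> +
      (if size \<nu> = 1 then - ((-1) ^ (n - sum_mset \<nu>) * of_nat ((n - 1) choose (n - sum_mset \<nu>))) else 0)))"

lemma cycle_star_expansion:
  assumes "n \<ge> 2"
  shows "is_star_expansion n (chromatic_sf (cycle_graph n)) (cycle_coeff n)"
proof -
  let ?g = "\<lambda>\<nu>. multi_coeff n \<nu> +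
      (if size \<nu> = 1 then - ((-1) ^ (n - sum_mset \<nu>) * of_nat ((n - 1) choose (n - sum_mset \<nu>))) else 0)"
  have one: "replicate_mset n 1 \<in> partitions n"
    by (auto simp: partitions_def sum_mset_replicate_mset)
  have ne: "pad n \<nu> \<noteq> replicate_mset n 1" if "\<nu> \<in> big_parts n" for \<nu>
    using bij_betwE[OF bij_betw_pad] that by auto
  have "chromatic_sf (cycle_graph n) = (\<Sum>\<nu>\<in>big_parts n. ?g \<nu> *\<^sub>Q star_sf_partition (pad n \<nu>))"
    using assms unfolding chromatic_cycle_eq[OF assms] mscale_eq_scalar scalar_add
    by (subst pow_sf_minus_star) (auto simp: distrib_right sum.distrib)
  also have "\<dots> = (\<Sum>\<nu>\<in>big_parts n. cycle_coeff n (pad n \<nu>) *\<^sub>Q star_sf_partition (pad n \<nu>))"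
    by (intro sum.cong refl) (simp only: cycle_coeff_def ne filter_pad if_False Let_def)
  also have "\<dots> = (\<Sum>\<mu>\<in>partitions n - {replicate_mset n 1}. cycle_coeff n \<mu> *\<^sub>Q star_sf_partition \<mu>)"
    by (rule sum.reindex_bij_betw[OF bij_betw_pad])
  \<comment> \<open>The partition into ones joins the sum with coefficient 0.\<close>
  also have "\<dots> = (\<Sum>\<mu>\<in>partitions n. cycle_coeff n \<mu> *\<^sub>Q star_sf_partition \<mu>)"
    using one by (simp add: sum.remove[OF finite_partitions one] cycle_coeff_def)
  finally show ?thesis by (simp add: is_star_expansion_def)
qed

lemma binom_of_nat: "binom (int a) (int b) = of_nat (a choose b)"
  by (auto simp: binom_def binomial_eq_0)

lemma multinom_eq_card_permutations:
  assumes "set_mset \<nu> \<subseteq> I" "finite I" "\<And>i. i \<in> I \<Longrightarrow> count \<nu> i = m i"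
  shows "multinom I m = of_nat (card (permutations_of_multiset \<nu>))"
proof -
  have "(\<Sum>i\<in>I. m i) = size \<nu>"
    unfolding size_multiset_overloaded_eq
    using assms by (intro sum.mono_neutral_cong_right) (auto simp: not_in_iff)
  moreover have "(\<Prod>i\<in>I. fact (m i) :: nat) = (\<Prod>i\<in>set_mset \<nu>. fact (count \<nu> i))"
    using assms by (intro prod.mono_neutral_cong_right) (auto simp: not_in_iff)
  ultimately have "card (permutations_of_multiset \<nu>) * (\<Prod>i\<in>I. fact (m i)) = fact (\<Sum>i\<in>I. m i)"
    using card_permutations_of_multiset_aux[of \<nu>] by (simp only:)
  then have "of_nat (card (permutations_of_multiset \<nu>)) * (\<Prod>i\<in>I. fact (m i) :: rat) = fact (\<Sum>i\<in>I. m i)"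
    by (metis (mono_tags, lifting) of_nat_fact of_nat_mult of_nat_prod prod.cong)
  moreover have "(\<Prod>i\<in>I. fact (m i) :: rat) \<noteq> 0"
    using assms(2) by simp
  ultimately show ?thesis
    unfolding multinom_def by (metis nonzero_eq_divide_eq)
qed

text \<open>The only big part is n - k, so both contributions occur and give n C(n-2, k) - C(n-1, k)
  up to sign. Pascal's rule for the second binomial yields the stated form.\<close>

lemma cycle_coeff_hook:
  assumes "n \<ge> 2" "k \<le> n - 2" "\<mu> = add_mset (n - k) (replicate_mset k 1)"
  shows "cycle_coeff n \<mu> = (-1) ^ k *
    (- binom (int n - 2) (int k - 1) + (of_nat n - 1) * binom (int n - 2) (int k))"
proof -
  have ne: "n - k \<noteq> 1" "n - (n - k) = k" using assms(1,2) by auto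
  have \<nu>: "filter_mset (\<lambda>i. i \<noteq> 1) \<mu> = {#n - k#}"
    using ne assms(3) by auto
  have "n - k \<in># \<mu>" using assms(3) by simp
  then have "\<mu> \<noteq> replicate_mset n 1" using ne(1) by (metis in_replicate_mset)
  then have c: "cycle_coeff n \<mu> = (-1) ^ k * (of_nat n * of_nat ((n - 2) choose k) - of_nat ((n - 1) choose k))"
    unfolding cycle_coeff_def \<nu> multi_coeff_def
    using ne(2) by (simp add: algebra_simps numeral_2_eq_2)
  have b: "binom (int n - 2) (int k) = of_nat ((n - 2) choose k)"
    using binom_of_nat[of "n - 2" k] assms(1) by (simp add: of_nat_diff)
  have "(of_nat ((n - 1) choose k) :: rat) = of_nat ((n - 2) choose k) + binom (int n - 2) (int k - 1)"
  proof (cases k)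
    \<comment> \<open>The lower index -1 is the default case of \<open>binom\<close>, with value
      0.\<close>
    case 0
    then show ?thesis by (simp add: binom_def)
  next
    case (Suc j)
    have "n - 1 = Suc (n - 2)" using assms(1) by simp
    then have "(n - 1) choose k = (n - 2 choose j) + (n - 2 choose k)"
      unfolding Suc by simp
    moreover have "binom (int n - 2) (int k - 1) = of_nat ((n - 2) choose j)"
      using binom_of_nat[of "n - 2" j] assms(1) Suc by (simp add: of_nat_diff)
    ultimately show ?thesis by simp
  qed
  then show ?thesis unfolding c b by (simp add: algebra_simps)
qed

text \<open>Outside the hooks there are at least two big parts, so p_n contributes nothing and
  \<open>multi_coeff\<close> alone remains. The length minus the number of ones is the number of big
  parts.\<close>

lemma cycle_coeff_not_hook:
  assumes "n \<ge> 1" "\<mu> \<in> partitions n" "\<not> is_hook n \<mu>"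
  shows "cycle_coeff n \<mu> = (-1) ^ count \<mu> 1 * (of_nat n / (of_nat (size \<mu>) - of_nat (count \<mu> 1)))
    * multinom {2..n} (count \<mu>) * binom (int n - int (size \<mu>) + int (count \<mu> 1) - 1) (int (count \<mu> 1))"
proof -
  have "replicate_mset n 1 = add_mset 1 (replicate_mset (n - 1) (1::nat))"
    using assms(1) by (cases n) auto
  then have "is_hook n (replicate_mset n 1)"
    using assms(1) by (auto simp: is_hook_def)
  with assms(3) have ne: "\<mu> \<noteq> replicate_mset n 1" by auto
  then have "\<mu> \<in> pad n ` big_parts n"
    using assms(2) bij_betw_imp_surj_on[OF bij_betw_pad, of n] by blast
  then obtain \<nu> where \<nu>n: "\<nu> \<in> big_parts n" and pad: "pad n \<nu> = \<mu>"
    by blast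
  have \<nu>: "filter_mset (\<lambda>i. i \<noteq> 1) \<mu> = \<nu>"
    using filter_pad[OF \<nu>n] pad by simp
  have le: "sum_mset \<nu> \<le> n" and sub: "set_mset \<nu> \<subseteq> {2..n}"
    using \<nu>n big_parts_le by (auto simp: big_parts_def)
  have count: "count \<mu> 1 = n - sum_mset \<nu>"
    using sub unfolding pad[symmetric] by (auto simp: pad_def not_in_iff)
  have size: "size \<mu> = size \<nu> + (n - sum_mset \<nu>)"
    unfolding pad[symmetric] by (simp add: pad_def)
  have "size \<nu> \<noteq> 1"
  proof
    assume "size \<nu> = 1"
    then obtain a where "\<nu> = {#a#}" using size_1_singleton_mset by blast
    then have "\<mu> = add_mset a (replicate_mset (n - a) 1)" "1 \<le> a" "a \<le> n"
      using pad sub by (auto simp: pad_def)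
    then show False using assms(3) by (auto simp: is_hook_def)
  qed
  moreover have "size \<nu> \<noteq> 0" using \<nu>n by (auto simp: big_parts_def)
  moreover have "2 * size \<nu> \<le> sum_mset \<nu>"
    using sub by (induction \<nu>) auto
  \<comment> \<open>Ensures that n - \<open>size \<nu>\<close> - 1 is not truncated and agrees with
    the integer upper index of \<open>binom\<close>.\<close>
  ultimately have "size \<nu> + 1 \<le> n" using le by linarith
  then have b: "binom (int n - int (size \<mu>) + int (count \<mu> 1) - 1) (int (count \<mu> 1)) =
      of_nat ((n - size \<nu> - 1) choose (n - sum_mset \<nu>))"
    unfolding size count using binom_of_nat[of "n - size \<nu> - 1"] by (simp add: of_nat_diff algebra_simps)
  have "multinom {2..n} (count \<mu>) = of_nat (card (permutations_of_multiset \<nu>))"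
    using sub by (intro multinom_eq_card_permutations) (auto simp flip: \<nu>)
  then show ?thesis
    using ne \<open>size \<nu> \<noteq> 1\<close> unfolding b
    by (simp add: cycle_coeff_def multi_coeff_def Let_def size count[simplified] \<nu>[simplified])
qed


theorem proposition4p4:
  fixes n :: nat
  assumes "n \<ge> 3"
  shows "(\<exists>c. is_star_expansion n (chromatic_sf (cycle_graph n)) c) \<and>
    (\<forall>c. is_star_expansion n (chromatic_sf (cycle_graph n)) c \<longrightarrow>
      (\<forall>\<mu>\<in>partitions n.
        (let m = count \<mu>; l = size \<mu> in
          (m 1 \<le> n - 2 \<and> \<mu> = add_mset (n - m 1) (replicate_mset (m 1) 1) \<longrightarrow>
            c \<mu> = (-1) ^ m 1 *
              (- binom (int n - 2) (int (m 1) - 1)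
               + (of_nat n - 1) * binom (int n - 2) (int (m 1)))) \<and>
          (\<not> is_hook n \<mu> \<longrightarrow>
            c \<mu> = (-1) ^ m 1 * (of_nat n / (of_nat l - of_nat (m 1)))
              * multinom {2..n} m
              * binom (int n - int l + int (m 1) - 1) (int (m 1))))) \<and>
      c (replicate_mset n 1) = 0)"
proof (intro conjI allI impI)
  have exp: "is_star_expansion n (chromatic_sf (cycle_graph n)) (cycle_coeff n)"
    using assms by (intro cycle_star_expansion) simp
  then show "\<exists>c. is_star_expansion n (chromatic_sf (cycle_graph n)) c" by blast
  fix c assume "is_star_expansion n (chromatic_sf (cycle_graph n)) c"
  \<comment> \<open>By uniqueness every expansion agrees with the explicit one, so the formulas are
    checked for \<open>cycle_coeff\<close> only.\<close>
  then have c: "c \<mu> = cycle_coeff n \<mu>" if "\<mu> \<in> partitions n" for \<mu>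
    using star_expansion_unique exp that by blast
  have "replicate_mset n 1 \<in> partitions n"
    by (auto simp: partitions_def sum_mset_replicate_mset)
  then show "c (replicate_mset n 1) = 0"
    using c by (simp add: cycle_coeff_def)
  have "n \<ge> 2" "n \<ge> 1" using assms by auto
  then show "\<forall>\<mu>\<in>partitions n.
        (let m = count \<mu>; l = size \<mu> in
          (m 1 \<le> n - 2 \<and> \<mu> = add_mset (n - m 1) (replicate_mset (m 1) 1) \<longrightarrow>
            c \<mu> = (-1) ^ m 1 *
              (- binom (int n - 2) (int (m 1) - 1)
               + (of_nat n - 1) * binom (int n - 2) (int (m 1)))) \<and>
          (\<not> is_hook n \<mu> \<longrightarrow>
            c \<mu> = (-1) ^ m 1 * (of_nat n / (of_nat l - of_nat (m 1)))
              * multinom {2..n} m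
              * binom (int n - int l + int (m 1) - 1) (int (m 1))))"
    unfolding Let_def
    by (intro ballI conjI impI)
      (simp_all only: c, elim conjE, erule (2) cycle_coeff_hook, erule (2) cycle_coeff_not_hook)
qed

end
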